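(* The timed problems DA-Reconf-TAR and DA-Reconf-TJ, parameterized by $k+\ell$, are fixed-parameter tractable. Here $\ell$ is the upper bound on the length of the reconfiguration sequence, and $k$ is the size of the alliances $A_s,A_t$ (for TJ) resp. the size threshold (for TAR).
   Context: For $A\subseteq V$, $d_A(v)=|N(v)\cap A|$; $A$ is a defensive alliance (DA) if $d_A(v)+1\ge d_{V\setminus A}(v)$ for all $v\in A$. $B$ is obtained from $A$ by a token jumping (TJ) step if $|A|=|B|$ and $|A\setminus B|=1$; by a token addition/removal (TAR) step if one of $A,B$ arises from the other by adding exactly one vertex. Timed DA-Reconf-$Y$: given $G$, defensive alliances $A_s,A_t$ (with $|A_s|=|A_t|=k$ for TJ), a bound $\ell$, and for $Y=\text{TAR}$ a threshold $k\in\mathbb{N}$, decide whether there is a sequence $A_s=A_1,\dots,A_m=A_t$ with $m\le\ell$ of defensive alliances (each of size at most $k$ if $Y=\text{TAR}$), each $A_{i+1}$ obtained from $A_i$ by a $Y$ step. *)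

theory Defs
  imports Main "HOL-Library.Log_Nat"
begin

section \<open>Random access machines\<close>

text \<open>
  The libraries offer no machine model with running times. We use a random access machine with
  structured control flow: finitely many registers (a program can only mention finitely many of
  them), an unbounded memory with indirect addressing, and addition and truncated subtraction as
  the only arithmetic. Each assignment and each test costs one step. Since the expressions
  of a fixed program have bounded size, this agrees up to a constant factor with charging every
  elementary operation. Without multiplication, words grow by only a constant number of bits per
  step, so the model is polynomially equivalent to Turing machines.
\<close>

datatype aexp = Const nat | Reg nat | Mem aexp | Plus aexp aexp | Minus aexp aexp

type_synonym state = "(nat \<Rightarrow> nat) \<times> (nat \<Rightarrow> nat)"

fun aval :: "aexp \<Rightarrow> state \<Rightarrow> nat" where
  "aval (Const n) s = n"
| "aval (Reg i) s = fst s i"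
| "aval (Mem a) s = snd s (aval a s)"
| "aval (Plus a b) s = aval a s + aval b s"
| "aval (Minus a b) s = aval a s - aval b s"

text \<open>Tests branch on whether the expression is nonzero.\<close>

datatype com =
    Skip
  | Assign nat aexp
  | Store aexp aexp
  | Seq com com
  | If aexp com com
  | While aexp com

inductive exec :: "com \<Rightarrow> state \<Rightarrow> nat \<Rightarrow> state \<Rightarrow> bool" where
  Skip: "exec Skip s 1 s"
| Assign: "exec (Assign i a) (r, m) 1 (r(i := aval a (r, m)), m)"
| Store: "exec (Store a b) (r, m) 1 (r, m(aval a (r, m) := aval b (r, m)))"
| Seq: "exec c1 s1 t1 s2 \<Longrightarrow> exec c2 s2 t2 s3 \<Longrightarrow> exec (Seq c1 c2) s1 (t1 + t2) s3"
| IfTrue: "aval a s \<noteq> 0 \<Longrightarrow> exec c1 s t s' \<Longrightarrow> exec (If a c1 c2) s (t + 1) s'"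
| IfFalse: "aval a s = 0 \<Longrightarrow> exec c2 s t s' \<Longrightarrow> exec (If a c1 c2) s (t + 1) s'"
| WhileFalse: "aval a s = 0 \<Longrightarrow> exec (While a c) s 1 s"
| WhileTrue: "aval a s1 \<noteq> 0 \<Longrightarrow> exec c s1 t1 s2 \<Longrightarrow> exec (While a c) s2 t2 s3
    \<Longrightarrow> exec (While a c) s1 (t1 + t2 + 1) s3"

inductive_cases SkipE: "exec Skip s t s'"
inductive_cases AssignE: "exec (Assign i a) s t s'"
inductive_cases StoreE: "exec (Store a b) s t s'"
inductive_cases SeqE: "exec (Seq c1 c2) s t s'"
inductive_cases IfE: "exec (If a c1 c2) s t s'"
inductive_cases WhileE: "exec (While a c) s t s'"

lemma exec_deterministic:
  "exec c s t s' \<Longrightarrow> exec c s u s'' \<Longrightarrow> u = t \<and> s'' = s'"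
proof (induction arbitrary: u s'' rule: exec.induct)
  case (Seq c1 s1 t1 s2 c2 t2 s3)
  from Seq.prems obtain u1 u2 r where "exec c1 s1 u1 r" "exec c2 r u2 s''" "u = u1 + u2"
    by (auto elim: SeqE)
  with Seq.IH show ?case by blast
next
  case (IfTrue a s c1 t s' c2)
  from IfTrue.prems IfTrue.hyps(1) obtain u1 where "exec c1 s u1 s''" "u = u1 + 1"
    by (auto elim: IfE)
  with IfTrue.IH show ?case by blast
next
  case (IfFalse a s c2 t s' c1)
  from IfFalse.prems IfFalse.hyps(1) obtain u1 where "exec c2 s u1 s''" "u = u1 + 1"
    by (auto elim: IfE)
  with IfFalse.IH show ?case by blast
next
  case (WhileTrue a s1 c t1 s2 t2 s3)
  from WhileTrue.prems WhileTrue.hyps(1) obtain u1 u2 r where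
    "exec c s1 u1 r" "exec (While a c) r u2 s''" "u = u1 + u2 + 1"
    by (auto elim: WhileE)
  with WhileTrue.IH show ?case by blast
qed (auto elim: SkipE AssignE StoreE WhileE)

text \<open>
  On input word \<open>x\<close> with parameter \<open>p\<close>, the machine starts with \<open>p\<close> in register 0,
  the length of \<open>x\<close> in register 1, the entries of \<open>x\<close> in the first memory cells,
  and zeros everywhere else. The result is read from register 0.
\<close>

definition initial :: "nat list \<Rightarrow> nat \<Rightarrow> state" where
  "initial x p = ((\<lambda>_. 0)(0 := p, 1 := length x), \<lambda>i. if i < length x then x ! i else 0)"

definition computable :: "(nat \<Rightarrow> nat) \<Rightarrow> bool" where
  "computable f \<longleftrightarrow> (\<exists>c. \<forall>p. \<exists>t s. exec c (initial [] p) t s \<and> fst s 0 = f p)"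


section \<open>Fixed-parameter tractability\<close>

text \<open>
  A parameterized problem is a set of pairs of an input word and a parameter. The size of a word
  is its length in bits: \<open>floorlog 2 a\<close> binary digits for each entry \<open>a\<close>, and one separator.
\<close>

type_synonym parameterized_problem = "(nat list \<times> nat) set"

definition input_size :: "nat list \<Rightarrow> nat" where
  "input_size x = (\<Sum>a\<leftarrow>x. floorlog 2 a + 1)"

definition fpt :: "parameterized_problem \<Rightarrow> bool" where
  "fpt L \<longleftrightarrow> (\<exists>c f d. computable f \<and>
     (\<forall>x p. \<exists>t s. exec c (initial x p) t s \<and>
        t \<le> f p * (input_size x + 1) ^ d \<and>
        fst s 0 = (if (x, p) \<in> L then 1 else 0)))"


section \<open>Defensive alliances and their reconfiguration\<close>

definition simple_graph :: "'a set \<Rightarrow> ('a \<times> 'a) set \<Rightarrow> bool" where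
  "simple_graph V E \<longleftrightarrow> finite V \<and> E \<subseteq> V \<times> V \<and> sym E \<and> irrefl E"

definition deg_in :: "('a \<times> 'a) set \<Rightarrow> 'a set \<Rightarrow> 'a \<Rightarrow> nat" where
  "deg_in E A v = card (E `` {v} \<inter> A)"

definition defensive_alliance :: "'a set \<Rightarrow> ('a \<times> 'a) set \<Rightarrow> 'a set \<Rightarrow> bool" where
  "defensive_alliance V E A \<longleftrightarrow>
     A \<subseteq> V \<and> (\<forall>v\<in>A. deg_in E A v + 1 \<ge> deg_in E (V - A) v)"

definition tj_step :: "'a set \<Rightarrow> 'a set \<Rightarrow> bool" where
  "tj_step A B \<longleftrightarrow> card A = card B \<and> card (A - B) = 1"

definition tar_step :: "'a set \<Rightarrow> 'a set \<Rightarrow> bool" where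
  "tar_step A B \<longleftrightarrow> (\<exists>v. v \<notin> A \<and> B = insert v A) \<or> (\<exists>v. v \<notin> B \<and> A = insert v B)"

definition tj_reconfigurable ::
  "'a set \<Rightarrow> ('a \<times> 'a) set \<Rightarrow> 'a set \<Rightarrow> 'a set \<Rightarrow> nat \<Rightarrow> bool" where
  "tj_reconfigurable V E As At l \<longleftrightarrow> (\<exists>S. S \<noteq> [] \<and> hd S = As \<and> last S = At \<and> length S \<le> l \<and>
     (\<forall>A\<in>set S. defensive_alliance V E A) \<and> successively tj_step S)"

definition tar_reconfigurable ::
  "'a set \<Rightarrow> ('a \<times> 'a) set \<Rightarrow> 'a set \<Rightarrow> 'a set \<Rightarrow> nat \<Rightarrow> nat \<Rightarrow> bool" where
  "tar_reconfigurable V E As At k l \<longleftrightarrow> (\<exists>S. S \<noteq> [] \<and> hd S = As \<and> last S = At \<and> length S \<le> l \<and>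
     (\<forall>A\<in>set S. defensive_alliance V E A \<and> card A \<le> k) \<and> successively tar_step S)"

text \<open>
  An instance on the vertices \<open>0, \<dots>, n - 1\<close> is encoded by the numbers \<open>n\<close>, \<open>k\<close>, \<open>l\<close>, followed
  by the rows of the adjacency matrix and the characteristic vectors of the two alliances.
\<close>

definition encode ::
  "nat \<Rightarrow> (nat \<times> nat) set \<Rightarrow> nat set \<Rightarrow> nat set \<Rightarrow> nat \<Rightarrow> nat \<Rightarrow> nat list" where
  "encode n E As At k l = [n, k, l]
     @ map (\<lambda>e. of_bool (e \<in> E)) (List.product [0..<n] [0..<n])
     @ map (\<lambda>v. of_bool (v \<in> As)) [0..<n]
     @ map (\<lambda>v. of_bool (v \<in> At)) [0..<n]"

lemma encode_inject:
  assumes "E \<subseteq> {..<n} \<times> {..<n}" "As \<subseteq> {..<n}" "At \<subseteq> {..<n}"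
    and "E' \<subseteq> {..<n'} \<times> {..<n'}" "As' \<subseteq> {..<n'}" "At' \<subseteq> {..<n'}"
    and eq: "encode n E As At k l = encode n' E' As' At' k' l'"
  shows "n = n' \<and> E = E' \<and> As = As' \<and> At = At' \<and> k = k' \<and> l = l'"
proof -
  have n: "n' = n" and k: "k' = k" and l: "l' = l"
    using eq by (simp_all add: encode_def)
  from eq have E: "\<forall>e\<in>{..<n} \<times> {..<n}. e \<in> E \<longleftrightarrow> e \<in> E'"
    and A: "\<forall>v\<in>{..<n}. v \<in> As \<longleftrightarrow> v \<in> As'" and B: "\<forall>v\<in>{..<n}. v \<in> At \<longleftrightarrow> v \<in> At'"
    unfolding encode_def n by (auto simp: of_bool_eq_iff)
  show ?thesis using assms E A B n k l by blast
qed

text \<open>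
  Words that do not encode an instance, and pairs in which the parameter is not \<open>k + l\<close>,
  are no-instances.
\<close>

definition DA_Reconf_TAR :: parameterized_problem where
  "DA_Reconf_TAR = {(encode n E As At k l, k + l) | n E As At k l.
     simple_graph {..<n} E \<and> defensive_alliance {..<n} E As \<and> defensive_alliance {..<n} E At \<and>
     tar_reconfigurable {..<n} E As At k l}"

definition DA_Reconf_TJ :: parameterized_problem where
  "DA_Reconf_TJ = {(encode n E As At k l, k + l) | n E As At k l.
     simple_graph {..<n} E \<and> defensive_alliance {..<n} E As \<and> defensive_alliance {..<n} E At \<and>
     card As = k \<and> card At = k \<and>
     tj_reconfigurable {..<n} E As At l}"

end

theory Submission
  imports Defs
begin

text \<open>
  A vertex of an alliance of size at most \<open>k\<close> has degree at most \<open>2 * k + 1\<close>, and any set of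
  vertices of degree at most 1 (leaves) can be added to an alliance. Let \<open>U\<close> be the union of all
  alliances of a reconfiguration sequence, so that \<open>card U \<le> k + l = p\<close>, and let \<open>K\<close> be the part
  of \<open>U\<close> that is connected within \<open>U\<close> to the two given alliances and the first \<open>2 * p\<close> leaves.
  Cutting all alliances down to \<open>K\<close> keeps them alliances, and for token jumping the
  tokens lost in this way can be parked on spare leaves. Hence it suffices to look for sequences
  inside the \<open>p\<close>-th neighbourhood of the seeds in the subgraph of low degree, whose size depends on
  \<open>p\<close> only. The machine tries all of them: it counts \<open>c\<close> up to \<open>2 ^ 2 ^ (4 * p + 5)\<close> and reads the
  digits of \<open>c\<close> as the vertices whose token is to be toggled.

  Bounded loops and bounded sums suffice for this, so the running time is polynomial in the largest
  loop bound.
\<close>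

section \<open>A language with bounded loops\<close>

text \<open>Cutting down to \<open>K\<close> is harmless because \<open>K\<close> is closed under
  adjacency inside \<open>U\<close>: no remaining member loses an allied neighbour. The pool has
  \<open>2 * p\<close> leaves because up to \<open>p\<close> of them may lie in \<open>U\<close>,
  and \<open>p\<close> more suffice for all parked tokens. The seeds number at most
  \<open>p + p + 2 * p\<close> and have degree at most \<open>2 * p + 1\<close>, so the search
  region \<open>W\<close> has at most \<open>4 * p * (2 * p + 2) ^ p\<close> vertices. A sequence
  becomes a number with at most \<open>2 * p\<close> digits in base \<open>card W + 1\<close>, the
  extra digit being the idle move, and \<open>2 ^ 2 ^ (4 * p + 5)\<close> exceeds all such numbers.
  So crude a bound is chosen because it arises by repeated doubling, without multiplication; the
  same code with a larger constant than 5 computes the function that \<open>fpt\<close> demands. The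
  time bound must hold on every word, also on one that encodes nothing. Therefore validity is one
  expression without early exit, the search runs in any case, and the two verdicts are joined at the
  end.\<close>

datatype ex =
    Num nat
  | Var nat
  | Len
  | Arr bool ex
  | Inp ex
  | Add ex ex
  | Sub ex ex
  | Ite ex ex ex
  | Sum nat nat ex

datatype prog =
    Put nat ex
  | Fill bool nat nat ex
  | PSeq prog prog
  | For nat nat prog

type_synonym env = "nat \<Rightarrow> nat"
type_synonym arrays = "bool \<Rightarrow> nat \<Rightarrow> nat"

primrec ev :: "nat list \<Rightarrow> ex \<Rightarrow> env \<Rightarrow> arrays \<Rightarrow> nat" where
  "ev x (Num c) r M = c"
| "ev x (Var i) r M = r i"
| "ev x Len r M = length x"
| "ev x (Arr j e) r M = M j (ev x e r M)"
| "ev x (Inp e) r M = (if ev x e r M < length x then x ! ev x e r M else 0)"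
| "ev x (Add a b) r M = ev x a r M + ev x b r M"
| "ev x (Sub a b) r M = ev x a r M - ev x b r M"
| "ev x (Ite a b c) r M = (if ev x a r M \<noteq> 0 then ev x b r M else ev x c r M)"
| "ev x (Sum i b e) r M = (\<Sum>k<r b. ev x e (r(i := k)) M)"

text \<open>\<open>Fill\<close> evaluates every cell in the old arrays, even when it overwrites the
  array that it reads. This makes one round of \<open>pGrow\<close> exactly one application of
  \<open>near\<close>.\<close>

primrec sem :: "nat list \<Rightarrow> prog \<Rightarrow> env \<times> arrays \<Rightarrow> env \<times> arrays" where
  "sem x (Put i e) s = ((fst s)(i := ev x e (fst s) (snd s)), snd s)"
| "sem x (Fill j i b e) s =
     (fst s, (snd s)(j := \<lambda>v. if v < fst s b then ev x e ((fst s)(i := v)) (snd s) else snd s j v))"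
| "sem x (PSeq P Q) s = sem x Q (sem x P s)"
| "sem x (For i b P) s = fold (\<lambda>k s. sem x P ((fst s)(i := k), snd s)) [0..<fst s b] s"

text \<open>Variables that bound a loop (\<open>ebv\<close>, \<open>bv\<close>) are kept apart from
  those that may be overwritten (\<open>ewv\<close>, \<open>wv\<close>). When they are disjoint,
  loop bounds never change, and one number \<open>B\<close> that dominates them at the start
  controls every iteration count.\<close>

primrec ebv :: "ex \<Rightarrow> nat set" where
  "ebv (Num c) = {}"
| "ebv (Var i) = {}"
| "ebv Len = {}"
| "ebv (Arr j e) = ebv e"
| "ebv (Inp e) = ebv e"
| "ebv (Add a b) = ebv a \<union> ebv b"
| "ebv (Sub a b) = ebv a \<union> ebv b"
| "ebv (Ite a b c) = ebv a \<union> ebv b \<union> ebv c"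
| "ebv (Sum i b e) = insert b (ebv e)"

primrec ewv :: "ex \<Rightarrow> nat set" where
  "ewv (Num c) = {}"
| "ewv (Var i) = {}"
| "ewv Len = {}"
| "ewv (Arr j e) = ewv e"
| "ewv (Inp e) = ewv e"
| "ewv (Add a b) = ewv a \<union> ewv b"
| "ewv (Sub a b) = ewv a \<union> ewv b"
| "ewv (Ite a b c) = ewv a \<union> ewv b \<union> ewv c"
| "ewv (Sum i b e) = insert i (ewv e)"

primrec bv :: "prog \<Rightarrow> nat set" where
  "bv (Put i e) = ebv e"
| "bv (Fill j i b e) = insert b (ebv e)"
| "bv (PSeq P Q) = bv P \<union> bv Q"
| "bv (For i b P) = insert b (bv P)"

primrec wv :: "prog \<Rightarrow> nat set" where
  "wv (Put i e) = insert i (ewv e)"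
| "wv (Fill j i b e) = insert i (ewv e)"
| "wv (PSeq P Q) = wv P \<union> wv Q"
| "wv (For i b P) = insert i (wv P)"

lemma sem_frame: "i \<notin> wv P \<Longrightarrow> fst (sem x P s) i = fst s i"
proof (induction P arbitrary: s)
  case (For j b P)
  have "fst (fold (\<lambda>k s. sem x P ((fst s)(j := k), snd s)) ks s) i = fst s i" for ks
    using For by (induction ks arbitrary: s) auto
  then show ?case by simp
qed auto

section \<open>Compilation to the random access machine\<close>

text \<open>
  Variable \<open>i\<close> lives in register \<open>2 * i\<close>, and the odd registers from 3 on form a stack of
  temporaries; register 1 keeps the input length. Behind the input, the memory interleaves the
  two arrays with a buffer.
\<close>

definition tmp :: "nat \<Rightarrow> nat" where
  "tmp d = 2 * d + 3"

lemma tmp_eq_iff [simp]: "tmp d = tmp d' \<longleftrightarrow> d = d'"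
  by (simp add: tmp_def)

lemma tmp_neq_even [simp]: "2 * i \<noteq> tmp d" "tmp d \<noteq> 2 * i" "tmp d \<noteq> Suc 0" "Suc 0 \<noteq> tmp d" "2 * i \<noteq> Suc 0"
  unfolding tmp_def by presburger+

definition offset :: "bool \<Rightarrow> nat" where
  "offset j = of_bool j"

text \<open>Addresses behind the input are taken modulo 3: offsets 0 and 1 are the two arrays,
  offset 2 is the buffer. The factor 3 is spelled out by additions.\<close>

definition cell :: "nat \<Rightarrow> aexp \<Rightarrow> aexp" where
  "cell j a = Plus (Reg 1) (Plus (Plus a (Plus a a)) (Const j))"

lemma aval_cell [simp]: "aval (cell j a) s = fst s 1 + (3 * aval a s + j)"
  by (simp add: cell_def)

text \<open>\<open>d\<close> is the stack height: the result goes to temporary \<open>d\<close>, and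
  lower ones survive. \<open>Sum\<close> keeps the partial sum, the old value of its index variable
  and a copy of the bound in three slots; restoring the index makes evaluation as free of side
  effects as \<open>ev\<close>.\<close>

primrec cex :: "ex \<Rightarrow> nat \<Rightarrow> com" where
  "cex (Num c) d = Assign (tmp d) (Const c)"
| "cex (Var i) d = Assign (tmp d) (Reg (2 * i))"
| "cex Len d = Assign (tmp d) (Reg 1)"
| "cex (Arr j e) d = Seq (cex e d) (Assign (tmp d) (Mem (cell (offset j) (Reg (tmp d)))))"
| "cex (Inp e) d = Seq (cex e d)
     (If (Minus (Reg 1) (Reg (tmp d))) (Assign (tmp d) (Mem (Reg (tmp d)))) (Assign (tmp d) (Const 0)))"
| "cex (Add a b) d = Seq (cex a d)
     (Seq (cex b (Suc d)) (Assign (tmp d) (Plus (Reg (tmp d)) (Reg (tmp (Suc d))))))"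
| "cex (Sub a b) d = Seq (cex a d)
     (Seq (cex b (Suc d)) (Assign (tmp d) (Minus (Reg (tmp d)) (Reg (tmp (Suc d))))))"
| "cex (Ite a b c) d = Seq (cex a d) (If (Reg (tmp d)) (cex b d) (cex c d))"
| "cex (Sum i b e) d =
     Seq (Assign (tmp d) (Const 0))
    (Seq (Assign (tmp (d + 1)) (Reg (2 * i)))
    (Seq (Assign (tmp (d + 2)) (Reg (2 * b)))
    (Seq (Assign (2 * i) (Const 0))
    (Seq (While (Minus (Reg (tmp (d + 2))) (Reg (2 * i)))
           (Seq (cex e (d + 3))
           (Seq (Assign (tmp d) (Plus (Reg (tmp d)) (Reg (tmp (d + 3)))))
                (Assign (2 * i) (Plus (Reg (2 * i)) (Const 1))))))
         (Assign (2 * i) (Reg (tmp (d + 1))))))))"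

text \<open>\<open>Fill\<close> makes two passes, first into the buffer and then from there into the
  array, since \<open>e\<close> may read the array being filled. \<open>For\<close> counts in a
  temporary, so the body may overwrite the index variable.\<close>

primrec cprog :: "prog \<Rightarrow> nat \<Rightarrow> com" where
  "cprog (Put i e) d = Seq (cex e d) (Assign (2 * i) (Reg (tmp d)))"
| "cprog (Fill j i b e) d =
     Seq (Assign (tmp d) (Reg (2 * i)))
    (Seq (Assign (tmp (d + 1)) (Reg (2 * b)))
    (Seq (Assign (2 * i) (Const 0))
    (Seq (While (Minus (Reg (tmp (d + 1))) (Reg (2 * i)))
           (Seq (cex e (d + 2))
           (Seq (Store (cell 2 (Reg (2 * i))) (Reg (tmp (d + 2))))
                (Assign (2 * i) (Plus (Reg (2 * i)) (Const 1))))))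
    (Seq (Assign (2 * i) (Const 0))
    (Seq (While (Minus (Reg (tmp (d + 1))) (Reg (2 * i)))
           (Seq (Store (cell (offset j) (Reg (2 * i))) (Mem (cell 2 (Reg (2 * i)))))
                (Assign (2 * i) (Plus (Reg (2 * i)) (Const 1)))))
         (Assign (2 * i) (Reg (tmp d))))))))"
| "cprog (PSeq P Q) d = Seq (cprog P d) (cprog Q d)"
| "cprog (For i b P) d =
     Seq (Assign (tmp d) (Reg (2 * b)))
    (Seq (Assign (tmp (d + 1)) (Const 0))
         (While (Minus (Reg (tmp d)) (Reg (tmp (d + 1))))
           (Seq (Assign (2 * i) (Reg (tmp (d + 1))))
           (Seq (cprog P (d + 2))
                (Assign (tmp (d + 1)) (Plus (Reg (tmp (d + 1))) (Const 1)))))))"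

section \<open>Step counts, polynomial in a common loop bound\<close>

primrec ecst :: "ex \<Rightarrow> nat \<Rightarrow> nat" where
  "ecst (Num c) B = 1"
| "ecst (Var i) B = 1"
| "ecst Len B = 1"
| "ecst (Arr j e) B = ecst e B + 1"
| "ecst (Inp e) B = ecst e B + 2"
| "ecst (Add a b) B = ecst a B + ecst b B + 1"
| "ecst (Sub a b) B = ecst a B + ecst b B + 1"
| "ecst (Ite a b c) B = ecst a B + ecst b B + ecst c B + 1"
| "ecst (Sum i b e) B = B * (ecst e B + 3) + 6"

primrec cst :: "prog \<Rightarrow> nat \<Rightarrow> nat" where
  "cst (Put i e) B = ecst e B + 1"
| "cst (Fill j i b e) B = B * (ecst e B + 3) + B * 3 + 7"
| "cst (PSeq P Q) B = cst P B + cst Q B"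
| "cst (For i b P) B = B * (cst P B + 3) + 3"

lemma poly_bound_add:
  assumes "\<And>B. f B \<le> K1 * (B + 1) ^ D1" "\<And>B. g B \<le> K2 * (B + 1) ^ D2"
  shows "f B + g B \<le> (K1 + K2) * ((B :: nat) + 1) ^ (D1 + D2)"
proof -
  have "(B + 1) ^ D1 \<le> (B + 1) ^ (D1 + D2)" "(B + 1) ^ D2 \<le> (B + 1) ^ (D1 + D2)"
    by (rule power_increasing; simp)+
  then have "K1 * (B + 1) ^ D1 + K2 * (B + 1) ^ D2 \<le> (K1 + K2) * (B + 1) ^ (D1 + D2)"
    by (simp add: add_mult_distrib add_mono)
  with assms[of B] show ?thesis by linarith
qed

definition poly_bounded :: "(nat \<Rightarrow> nat) \<Rightarrow> bool" where
  "poly_bounded f \<longleftrightarrow> (\<exists>K D. \<forall>B. f B \<le> K * (B + 1) ^ D)"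

lemma poly_bounded_const: "poly_bounded (\<lambda>B. c)"
  unfolding poly_bounded_def by (rule exI[of _ c], rule exI[of _ 0]) simp

lemma poly_bounded_id: "poly_bounded (\<lambda>B. B)"
  unfolding poly_bounded_def by (rule exI[of _ 1], rule exI[of _ 1]) simp

lemma poly_bounded_add: "poly_bounded f \<Longrightarrow> poly_bounded g \<Longrightarrow> poly_bounded (\<lambda>B. f B + g B)"
  unfolding poly_bounded_def using poly_bound_add by metis

lemma poly_bounded_mult:
  assumes "poly_bounded f" "poly_bounded g"
  shows "poly_bounded (\<lambda>B. f B * g B)"
proof -
  obtain K1 D1 where 1: "\<And>B. f B \<le> K1 * (B + 1) ^ D1"
    using assms(1) unfolding poly_bounded_def by blast
  obtain K2 D2 where 2: "\<And>B. g B \<le> K2 * (B + 1) ^ D2"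
    using assms(2) unfolding poly_bounded_def by blast
  have "f B * g B \<le> (K1 * (B + 1) ^ D1) * (K2 * (B + 1) ^ D2)" for B
    using 1 2 by (intro mult_mono) auto
  then have "f B * g B \<le> (K1 * K2) * (B + 1) ^ (D1 + D2)" for B
    by (simp add: power_add mult_ac)
  then show ?thesis unfolding poly_bounded_def by blast
qed

lemmas poly_bounded_intros =
  poly_bounded_const poly_bounded_id poly_bounded_add poly_bounded_mult

lemma poly_bounded_ecst: "poly_bounded (\<lambda>B. ecst e B)"
  by (induction e; (unfold ecst.simps)?; (intro poly_bounded_intros; assumption)?)

text \<open>Each nesting level of loops contributes one factor \<open>B\<close>, so the degree
  depends on the program only, as the exponent in \<open>fpt\<close> must.\<close>

lemma poly_bounded_cst: "poly_bounded (\<lambda>B. cst P B)"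
  by (induction P; (unfold cst.simps)?; (intro poly_bounded_intros poly_bounded_ecst; assumption)?)

section \<open>Total correctness with time bounds\<close>

definition runs :: "com \<Rightarrow> state \<Rightarrow> nat \<Rightarrow> (state \<Rightarrow> bool) \<Rightarrow> bool" where
  "runs c s T Q \<longleftrightarrow> (\<exists>t s'. exec c s t s' \<and> t \<le> T \<and> Q s')"

lemma runs_mono: "runs c s T Q \<Longrightarrow> T \<le> T' \<Longrightarrow> (\<And>s'. Q s' \<Longrightarrow> Q' s') \<Longrightarrow> runs c s T' Q'"
  unfolding runs_def by (meson order_trans)

lemma runs_Assign: "Q ((fst s)(i := aval a s), snd s) \<Longrightarrow> 0 < T \<Longrightarrow> runs (Assign i a) s T Q"
  unfolding runs_def using exec.Assign[of i a "fst s" "snd s"]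
  by (metis One_nat_def Suc_leI prod.collapse)

lemma runs_Store: "Q (fst s, (snd s)(aval a s := aval b s)) \<Longrightarrow> 0 < T \<Longrightarrow> runs (Store a b) s T Q"
  unfolding runs_def using exec.Store[of a b "fst s" "snd s"]
  by (metis One_nat_def Suc_leI prod.collapse)

lemma runs_Seq:
  assumes "runs c1 s T1 R" "\<And>s'. R s' \<Longrightarrow> runs c2 s' T2 Q"
  shows "runs (Seq c1 c2) s (T1 + T2) Q"
  using assms unfolding runs_def by (meson add_mono exec.Seq)

lemma runs_SeqAssign:
  assumes "runs c2 ((fst s)(i := aval a s), snd s) T Q"
  shows "runs (Seq (Assign i a) c2) s (T + 1) Q"
  using runs_Seq[OF runs_Assign[where Q = "\<lambda>s'. s' = ((fst s)(i := aval a s), snd s)" and T = 1], of s i a c2 T Q]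
    assms by simp

lemma runs_If:
  assumes "aval a s \<noteq> 0 \<Longrightarrow> runs c1 s T Q" "aval a s = 0 \<Longrightarrow> runs c2 s T Q"
  shows "runs (If a c1 c2) s (T + 1) Q"
  using assms unfolding runs_def by (cases "aval a s = 0") (meson add_le_mono1 exec.IfTrue exec.IfFalse)+

text \<open>The invariant is indexed by the number of completed rounds, which replaces a termination
  measure; the induction is on the rounds that remain. Each round pays one test, and the failing
  last test pays the final 1.\<close>

lemma runs_While:
  assumes step: "\<And>k s. k < n \<Longrightarrow> I k s \<Longrightarrow> aval a s \<noteq> 0 \<and> runs c s T (I (Suc k))"
    and stop: "\<And>s. I n s \<Longrightarrow> aval a s = 0"
    and "I 0 s"
  shows "runs (While a c) s (n * (T + 1) + 1) (I n)"
proof -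
  have "runs (While a c) s (j * (T + 1) + 1) (I n)" if "j \<le> n" "I (n - j) s" for j s
    using that
  proof (induction j arbitrary: s)
    case 0
    then have "I n s" by simp
    with stop have "exec (While a c) s 1 s" by (blast intro: exec.WhileFalse)
    with \<open>I n s\<close> show ?case unfolding runs_def by (metis le_add2)
  next
    case (Suc j)
    with step[of "n - Suc j" s] have a: "aval a s \<noteq> 0" and "runs c s T (I (n - j))"
      by (simp_all add: Suc_diff_Suc)
    then obtain t1 s1 where 1: "exec c s t1 s1" "t1 \<le> T" "I (n - j) s1"
      unfolding runs_def by blast
    with Suc.IH[of s1] Suc.prems obtain t2 s2 where
      2: "exec (While a c) s1 t2 s2" "t2 \<le> j * (T + 1) + 1" "I n s2"
      unfolding runs_def by auto
    have "t1 + t2 + 1 \<le> Suc j * (T + 1) + 1" using 1(2) 2(2) by simp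
    with exec.WhileTrue[OF a 1(1) 2(1)] 2(3) show ?case unfolding runs_def by blast
  qed
  from this[of n s] assms(3) show ?thesis by simp
qed

section \<open>Simulation of the language by compiled code\<close>

definition conc :: "nat list \<Rightarrow> env \<Rightarrow> arrays \<Rightarrow> state \<Rightarrow> bool" where
  "conc x r M s \<longleftrightarrow> fst s 1 = length x \<and> (\<forall>i. fst s (2 * i) = r i) \<and>
     (\<forall>a < length x. snd s a = x ! a) \<and>
     (\<forall>j v. snd s (length x + (3 * v + offset j)) = M j v)"

definition keep :: "nat \<Rightarrow> state \<Rightarrow> state \<Rightarrow> bool" where
  "keep d s s' \<longleftrightarrow> (\<forall>d' < d. fst s' (tmp d') = fst s (tmp d'))"

lemma conc_tmp [simp]: "conc x r M (rc(tmp d := a), m) = conc x r M (rc, m)"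
  by (simp add: conc_def)

lemma conc_var: "conc x r M (rc, m) \<Longrightarrow> conc x (r(i := a)) M (rc(2 * i := a), m)"
  by (auto simp: conc_def)

lemma keep_refl [simp]: "keep d s s"
  by (simp add: keep_def)

lemma conc_reg: "conc x r M s \<Longrightarrow> fst s (2 * i) = r i" "conc x r M s \<Longrightarrow> fst s 1 = length x"
  "conc x r M s \<Longrightarrow> fst s (Suc 0) = length x"
  by (simp_all add: conc_def)

text \<open>The memory must be literally unchanged, not just represent the same arrays: during the
  first pass of \<open>Fill\<close> the buffer, which \<open>conc\<close> does not see, holds the
  values computed so far.\<close>

definition exspec :: "nat list \<Rightarrow> ex \<Rightarrow> nat \<Rightarrow> env \<Rightarrow> arrays \<Rightarrow> state \<Rightarrow> state \<Rightarrow> bool" where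
  "exspec x e d r M s s' \<longleftrightarrow> conc x r M s' \<and> keep d s s' \<and> snd s' = snd s \<and> fst s' (tmp d) = ev x e r M"

lemma cex_correct:
  assumes "conc x r M s" "\<forall>b\<in>ebv e. r b \<le> B" "ebv e \<inter> ewv e = {}"
  shows "runs (cex e d) s (ecst e B) (exspec x e d r M s)"
  using assms
proof (induction e arbitrary: d r s)
  case (Num c)
  then show ?case
    by (auto intro!: runs_Assign simp: exspec_def keep_def)
next
  case (Var i)
  then show ?case
    by (auto intro!: runs_Assign simp: exspec_def keep_def conc_reg)
next
  case Len
  then show ?case
    by (auto intro!: runs_Assign simp: exspec_def keep_def conc_reg)
next
  case (Arr j e)
  have "runs (cex e d) s (ecst e B) (exspec x e d r M s)"
    using Arr by simp
  then show ?case unfolding cex.simps ecst.simps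
    by (rule runs_Seq) (auto intro!: runs_Assign simp: exspec_def keep_def conc_def)
next
  case (Inp e)
  have "runs (cex e d) s (ecst e B) (exspec x e d r M s)"
    using Inp by simp
  moreover have "runs (If (Minus (Reg 1) (Reg (tmp d))) (Assign (tmp d) (Mem (Reg (tmp d)))) (Assign (tmp d) (Const 0)))
    s' (1 + 1) (exspec x (Inp e) d r M s)" if "exspec x e d r M s s'" for s'
    using that by (intro runs_If runs_Assign) (auto simp: exspec_def keep_def conc_def)
  ultimately show ?case unfolding cex.simps ecst.simps one_add_one[symmetric]
    by (rule runs_Seq)
next
  case (Add a b)
  have 1: "runs (cex a d) s (ecst a B) (exspec x a d r M s)"
    by (rule Add.IH(1)) (use Add.prems in auto)
  have 2: "runs (cex b (Suc d)) s' (ecst b B) (exspec x b (Suc d) r M s')"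
    if "exspec x a d r M s s'" for s'
    by (rule Add.IH(2)) (use Add.prems that in \<open>auto simp: exspec_def\<close>)
  show ?case unfolding cex.simps ecst.simps add.assoc
    by (rule runs_Seq[OF 1], rule runs_Seq[OF 2], assumption)
      (auto intro!: runs_Assign simp: exspec_def keep_def)
next
  case (Sub a b)
  have 1: "runs (cex a d) s (ecst a B) (exspec x a d r M s)"
    by (rule Sub.IH(1)) (use Sub.prems in auto)
  have 2: "runs (cex b (Suc d)) s' (ecst b B) (exspec x b (Suc d) r M s')"
    if "exspec x a d r M s s'" for s'
    by (rule Sub.IH(2)) (use Sub.prems that in \<open>auto simp: exspec_def\<close>)
  show ?case unfolding cex.simps ecst.simps add.assoc
    by (rule runs_Seq[OF 1], rule runs_Seq[OF 2], assumption)
      (auto intro!: runs_Assign simp: exspec_def keep_def)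
next
  case (Ite a b c)
  have 1: "runs (cex a d) s (ecst a B) (exspec x a d r M s)"
    by (rule Ite.IH(1)) (use Ite.prems in auto)
  have 2: "runs (cex b d) s' (ecst b B) (exspec x b d r M s')"
     "runs (cex c d) s' (ecst c B) (exspec x c d r M s')" if "exspec x a d r M s s'" for s'
    by (rule Ite.IH(2) Ite.IH(3); use Ite.prems that in \<open>auto simp: exspec_def\<close>)+
  have "runs (If (Reg (tmp d)) (cex b d) (cex c d)) s' (ecst b B + ecst c B + 1)
     (exspec x (Ite a b c) d r M s)" if s': "exspec x a d r M s s'" for s'
    by (rule runs_If; rule runs_mono, rule 2[OF s'])
      (use s' in \<open>auto simp: exspec_def keep_def\<close>)
  from runs_Seq[OF 1 this] show ?case by (simp add: add.assoc)
next
  case (Sum i b e)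
  define I where "I = (\<lambda>k s'. conc x (r(i := k)) M s' \<and> keep d s s' \<and> snd s' = snd s \<and>
    fst s' (tmp d) = (\<Sum>k<k. ev x e (r(i := k)) M) \<and> fst s' (tmp (d + 1)) = r i \<and>
    fst s' (tmp (d + 2)) = r b)"
  let ?body = "Seq (cex e (d + 3))
           (Seq (Assign (tmp d) (Plus (Reg (tmp d)) (Reg (tmp (d + 3)))))
                (Assign (2 * i) (Plus (Reg (2 * i)) (Const 1))))"
  have body: "aval (Minus (Reg (tmp (d + 2))) (Reg (2 * i))) s' \<noteq> 0 \<and>
     runs ?body s' (ecst e B + 2) (I (Suc k))" if k: "k < r b" and I: "I k s'" for k s'
  proof
    have c: "conc x (r(i := k)) M s'" using I by (simp add: I_def)
    show "aval (Minus (Reg (tmp (d + 2))) (Reg (2 * i))) s' \<noteq> 0"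
      using I k conc_reg(1)[OF c, of i] by (simp add: I_def)
    have "runs (cex e (d + 3)) s' (ecst e B) (exspec x e (d + 3) (r(i := k)) M s')"
      \<comment> \<open>Disjointness puts \<open>i\<close> outside \<open>ebv e\<close>, so the
        bound by \<open>B\<close> survives the change from \<open>r\<close> to
        \<open>r(i := k)\<close>.\<close>
      by (rule Sum.IH[OF c]) (use Sum.prems in auto)
    then show "runs ?body s' (ecst e B + 2) (I (Suc k))"
    proof (rule runs_Seq)
      fix s2 assume s2: "exspec x e (d + 3) (r(i := k)) M s' s2"
      have c2: "conc x (r(i := k)) M s2" using s2 by (simp add: exspec_def)
      have c3: "conc x (r(i := Suc k)) M (rc(2 * i := Suc k), m)" if "conc x (r(i := k)) M (rc, m)" for k rc m
        using conc_var[OF that, of i "Suc k"] by simp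
      have "runs (Seq (Assign (tmp d) (Plus (Reg (tmp d)) (Reg (tmp (d + 3)))))
                (Assign (2 * i) (Plus (Reg (2 * i)) (Const 1)))) s2 (1 + 1) (I (Suc k))"
        apply (intro runs_SeqAssign runs_Assign)
        using I s2 c2 conc_reg(1)[OF c2, of i]
        by (cases s2) (auto simp: I_def exspec_def keep_def intro!: c3)
      then show "runs (Seq (Assign (tmp d) (Plus (Reg (tmp d)) (Reg (tmp (d + 3)))))
                (Assign (2 * i) (Plus (Reg (2 * i)) (Const 1)))) s2 2 (I (Suc k))"
        by (simp only: one_add_one)
    qed
  qed
  let ?loop = "While (Minus (Reg (tmp (d + 2))) (Reg (2 * i))) ?body"
  have loop: "runs ?loop s' (r b * (ecst e B + 2 + 1) + 1) (I (r b))" if "I 0 s'" for s'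
    by (rule runs_While[where I = I, OF body _ that]) (auto simp: I_def dest!: conc_reg(1)[where i = i])
  have fin: "runs (Assign (2 * i) (Reg (tmp (d + 1)))) s' 1 (exspec x (Sum i b e) d r M s)" if "I (r b) s'" for s'
    using that conc_var[of x "r(i := r b)" M "fst s'" "snd s'" i "r i"]
    by (cases s', intro runs_Assign) (auto simp: I_def exspec_def keep_def)
  have I0: "I 0 (((fst s)(tmp d := 0, tmp (d + 1) := r i, tmp (d + 2) := r b, 2 * i := 0)), snd s)"
    using Sum.prems(1) unfolding I_def
    by (auto simp: keep_def intro!: conc_var)
  note seq = runs_Seq[OF loop[OF I0] fin]
  have "runs (cex (Sum i b e) d) s (r b * (ecst e B + 2 + 1) + 1 + 1 + 1 + 1 + 1 + 1) (exspec x (Sum i b e) d r M s)"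
    unfolding cex.simps
    by (intro runs_SeqAssign) (use seq Sum.prems(1) in \<open>simp add: conc_reg\<close>)
  moreover have "r b * (ecst e B + 2 + 1) \<le> B * (ecst e B + 3)"
    using Sum.prems(2) by (intro mult_mono) auto
  ultimately show ?case
    by (elim runs_mono) auto
qed

definition pspec :: "nat list \<Rightarrow> nat \<Rightarrow> env \<times> arrays \<Rightarrow> state \<Rightarrow> state \<Rightarrow> bool" where
  "pspec x d rM s s' \<longleftrightarrow> conc x (fst rM) (snd rM) s' \<and> keep d s s'"

text \<open>Offset 2 modulo 3 never meets an array cell.\<close>

lemma conc_buffer: "conc x r M (rc, m) \<Longrightarrow> conc x r M (rc, m(length x + (3 * k + 2) := a))"
proof -
  have "3 * v + offset j \<noteq> 3 * k + 2" for v j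
    by (cases j) (simp_all add: offset_def, presburger+)
  then show "conc x r M (rc, m) \<Longrightarrow> conc x r M (rc, m(length x + (3 * k + 2) := a))"
    by (auto simp: conc_def)
qed

lemma conc_store: "conc x r M (rc, m) \<Longrightarrow>
  conc x r (M(j := (M j)(k := a))) (rc, m(length x + (3 * k + offset j) := a))"
proof -
  have "3 * v + offset i = 3 * k + offset j \<longleftrightarrow> v = k \<and> i = j" for v i
    by (cases j; cases i) (simp_all add: offset_def, presburger+)
  then show "conc x r M (rc, m) \<Longrightarrow>
      conc x r (M(j := (M j)(k := a))) (rc, m(length x + (3 * k + offset j) := a))"
    by (auto simp: conc_def)
qed


lemma cprog_correct:
  assumes "conc x r M s" "\<forall>b\<in>bv P. r b \<le> B" "bv P \<inter> wv P = {}"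
  shows "runs (cprog P d) s (cst P B) (pspec x d (sem x P (r, M)) s)"
  using assms
proof (induction P arbitrary: d r M s)
  case (Put i e)
  have "runs (cex e d) s (ecst e B) (exspec x e d r M s)"
    by (rule cex_correct) (use Put in auto)
  moreover have "runs (Assign (2 * i) (Reg (tmp d))) s' 1 (pspec x d (sem x (Put i e) (r, M)) s)"
    if "exspec x e d r M s s'" for s'
    using that conc_var[of x r M "fst s'" "snd s'" i "ev x e r M"]
    by (cases s', intro runs_Assign) (auto simp: exspec_def pspec_def keep_def)
  ultimately show ?case unfolding cprog.simps cst.simps by (rule runs_Seq)
next
  case (PSeq P Q)
  have 1: "runs (cprog P d) s (cst P B) (pspec x d (sem x P (r, M)) s)"
    by (rule PSeq.IH(1)) (use PSeq.prems in auto)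
  have fr: "fst (sem x P (r, M)) b = r b" if "b \<in> bv Q" for b
    using sem_frame[of b P x "(r, M)"] that PSeq.prems(3) by auto
  have 2: "runs (cprog Q d) s' (cst Q B) (pspec x d (sem x (PSeq P Q) (r, M)) s)"
    if s': "pspec x d (sem x P (r, M)) s s'" for s'
  proof (rule runs_mono)
    show "runs (cprog Q d) s' (cst Q B) (pspec x d (sem x Q (fst (sem x P (r, M)), snd (sem x P (r, M)))) s')"
      by (rule PSeq.IH(2)) (use PSeq.prems s' fr in \<open>auto simp: pspec_def\<close>)
  qed (use s' in \<open>auto simp: pspec_def keep_def\<close>)
  show ?case unfolding cprog.simps cst.simps by (rule runs_Seq[OF 1 2])
next
  case (For i b P)
  define st where "st = (\<lambda>k. fold (\<lambda>k s. sem x P ((fst s)(i := k), snd s)) [0..<k] (r, M))"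
  have st_frame: "fst (st k) j = r j" if "j \<in> bv (For i b P)" for k j
  proof -
    have j: "j \<noteq> i" "j \<notin> wv P" using that For.prems(3) by auto
    have "fst (fold (\<lambda>k s. sem x P ((fst s)(i := k), snd s)) ks s) j = fst s j" for ks and s :: "env \<times> arrays"
      using sem_frame[OF j(2)] j(1) by (induction ks arbitrary: s) auto
    then show ?thesis by (simp add: st_def)
  qed
  have st_Suc: "st (Suc k) = sem x P ((fst (st k))(i := k), snd (st k))" for k
    by (simp add: st_def)
  define I where "I = (\<lambda>k s'. pspec x d (st k) s s' \<and> fst s' (tmp d) = r b \<and> fst s' (tmp (d + 1)) = k)"
  let ?body = "Seq (Assign (2 * i) (Reg (tmp (d + 1)))) (Seq (cprog P (d + 2))
                (Assign (tmp (d + 1)) (Plus (Reg (tmp (d + 1))) (Const 1))))"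
  have body: "aval (Minus (Reg (tmp d)) (Reg (tmp (d + 1)))) s' \<noteq> 0 \<and>
     runs ?body s' (cst P B + 1 + 1) (I (Suc k))" if k: "k < r b" and I: "I k s'" for k s'
  proof
    show "aval (Minus (Reg (tmp d)) (Reg (tmp (d + 1)))) s' \<noteq> 0"
      using I k by (simp add: I_def)
    define s1 where "s1 = ((fst s')(2 * i := k), snd s')"
    have c1: "conc x ((fst (st k))(i := k)) (snd (st k)) s1"
      unfolding s1_def by (rule conc_var) (use I in \<open>simp add: I_def pspec_def\<close>)
    have "runs (cprog P (d + 2)) s1 (cst P B)
       (pspec x (d + 2) (sem x P ((fst (st k))(i := k), snd (st k))) s1)"
    proof (rule For.IH[OF c1])
      show "\<forall>j\<in>bv P. ((fst (st k))(i := k)) j \<le> B"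
        using For.prems(2,3) st_frame by auto
    qed (use For.prems(3) in auto)
    then have "runs (Seq (cprog P (d + 2)) (Assign (tmp (d + 1)) (Plus (Reg (tmp (d + 1))) (Const 1)))) s1
       (cst P B + 1) (I (Suc k))"
      by (rule runs_Seq) (use I in \<open>auto intro!: runs_Assign simp: I_def pspec_def keep_def s1_def st_Suc\<close>)
    then show "runs ?body s' (cst P B + 1 + 1) (I (Suc k))"
      by (intro runs_SeqAssign) (use I in \<open>simp add: s1_def I_def\<close>)
  qed
  let ?s0 = "((fst s)(tmp d := r b, tmp (d + 1) := 0), snd s)"
  have I0: "I 0 ?s0"
    using For.prems(1) by (auto simp: I_def pspec_def st_def keep_def)
  have "runs (While (Minus (Reg (tmp d)) (Reg (tmp (d + 1)))) ?body) ?s0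
     (r b * (cst P B + 1 + 1 + 1) + 1) (I (r b))"
    by (rule runs_While[where I = I, OF body]) (use I0 in \<open>auto simp: I_def\<close>)
  then have "runs (cprog (For i b P) d) s (r b * (cst P B + 1 + 1 + 1) + 1 + 1 + 1) (I (r b))"
    unfolding cprog.simps by (intro runs_SeqAssign) (use For.prems(1) in \<open>simp add: conc_reg\<close>)
  moreover have "r b * (cst P B + 1 + 1 + 1) \<le> B * (cst P B + 3)"
    using For.prems(2) by (intro mult_mono) auto
  ultimately show ?case
    by (elim runs_mono) (auto simp: I_def st_def)
next
  case (Fill j i b e)
  define val where "val = (\<lambda>v. ev x e (r(i := v)) M)"
  define M' where "M' = (\<lambda>n. M(j := \<lambda>v. if v < n then val v else M j v))"
  define J where "J = (\<lambda>s'. keep d s s' \<and> fst s' (tmp d) = r i \<and> fst s' (tmp (d + 1)) = r b)"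
  \<comment> \<open>In the first pass the values pile up in the buffer while the arrays still
    represent \<open>M\<close>; in the second, the first \<open>k\<close> cells of array
    \<open>j\<close> have been replaced and the buffer is complete.\<close>
  define I1 where "I1 = (\<lambda>k s'. conc x (r(i := k)) M s' \<and> J s' \<and>
    (\<forall>v<k. snd s' (length x + (3 * v + 2)) = val v))"
  define I2 where "I2 = (\<lambda>k s'. conc x (r(i := k)) (M' k) s' \<and> J s' \<and>
    (\<forall>v<r b. snd s' (length x + (3 * v + 2)) = val v))"
  let ?a = "Minus (Reg (tmp (d + 1))) (Reg (2 * i))"
  let ?inc = "Assign (2 * i) (Plus (Reg (2 * i)) (Const 1))"
  let ?b1 = "Seq (cex e (d + 2)) (Seq (Store (cell 2 (Reg (2 * i))) (Reg (tmp (d + 2)))) ?inc)"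
  let ?b2 = "Seq (Store (cell (offset j) (Reg (2 * i))) (Mem (cell 2 (Reg (2 * i))))) ?inc"
  have inc: "conc x (r(i := Suc k)) M0 (rc(2 * i := Suc k), m)" if "conc x (r(i := k)) M0 (rc, m)" for k M0 rc m
    using conc_var[OF that, of i "Suc k"] by simp
  have body1: "aval ?a s' \<noteq> 0 \<and> runs ?b1 s' (ecst e B + (1 + 1)) (I1 (Suc k))"
    if k: "k < r b" and I: "I1 k s'" for k s'
  proof
    have c: "conc x (r(i := k)) M s'" using I by (simp add: I1_def)
    show "aval ?a s' \<noteq> 0"
      using I k conc_reg(1)[OF c, of i] by (simp add: I1_def J_def)
    have 1: "runs (cex e (d + 2)) s' (ecst e B) (exspec x e (d + 2) (r(i := k)) M s')"
      by (rule cex_correct[OF c]) (use Fill.prems in auto)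
    have 2: "runs (Store (cell 2 (Reg (2 * i))) (Reg (tmp (d + 2)))) s2 1
        (\<lambda>s3. conc x (r(i := k)) M s3 \<and> J s3 \<and> (\<forall>v<Suc k. snd s3 (length x + (3 * v + 2)) = val v))"
      if s2: "exspec x e (d + 2) (r(i := k)) M s' s2" for s2
    proof (rule runs_Store)
      have c2: "conc x (r(i := k)) M s2" using s2 by (simp add: exspec_def)
      show "conc x (r(i := k)) M (fst s2, (snd s2)(aval (cell 2 (Reg (2 * i))) s2 := aval (Reg (tmp (d + 2))) s2)) \<and>
        J (fst s2, (snd s2)(aval (cell 2 (Reg (2 * i))) s2 := aval (Reg (tmp (d + 2))) s2)) \<and>
        (\<forall>v<Suc k. snd (fst s2, (snd s2)(aval (cell 2 (Reg (2 * i))) s2 := aval (Reg (tmp (d + 2))) s2))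
           (length x + (3 * v + 2)) = val v)"
        using I s2 c2 conc_reg[OF c2] conc_buffer[of x "r(i := k)" M "fst s2" "snd s2" k]
        by (cases s2, cases s') (auto simp: I1_def J_def exspec_def keep_def val_def less_Suc_eq)
    qed simp
    show "runs ?b1 s' (ecst e B + (1 + 1)) (I1 (Suc k))"
    proof (rule runs_Seq[OF 1], rule runs_Seq[OF 2], assumption, rule runs_Assign)
      fix s3
      assume s3: "conc x (r(i := k)) M s3 \<and> J s3 \<and> (\<forall>v<Suc k. snd s3 (length x + (3 * v + 2)) = val v)"
      then have c3: "conc x (r(i := k)) M s3" by simp
      show "I1 (Suc k) ((fst s3)(2 * i := aval (Plus (Reg (2 * i)) (Const 1)) s3), snd s3)"
        using s3 inc[of k M "fst s3" "snd s3"] conc_reg(1)[OF c3, of i]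
        by (auto simp: I1_def J_def keep_def)
    qed simp
  qed
  have body2: "aval ?a s' \<noteq> 0 \<and> runs ?b2 s' (1 + 1) (I2 (Suc k))"
    if k: "k < r b" and I: "I2 k s'" for k s'
  proof
    have c: "conc x (r(i := k)) (M' k) s'" using I by (simp add: I2_def)
    show "aval ?a s' \<noteq> 0"
      using I k conc_reg(1)[OF c, of i] by (simp add: I2_def J_def)
    have M'_Suc: "M' (Suc k) = (M' k)(j := (M' k j)(k := val k))"
      by (auto simp: M'_def fun_eq_iff less_Suc_eq)
    have neq: "3 * v + 2 \<noteq> 3 * k + offset j" for v
      unfolding offset_def by (cases j; simp; presburger)
    show "runs ?b2 s' (1 + 1) (I2 (Suc k))"
    proof (rule runs_Seq[where R = "\<lambda>s2. conc x (r(i := k)) (M' (Suc k)) s2 \<and> J s2 \<and>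
        (\<forall>v<r b. snd s2 (length x + (3 * v + 2)) = val v)"], rule runs_Store)
      show "conc x (r(i := k)) (M' (Suc k)) (fst s', (snd s')(aval (cell (offset j) (Reg (2 * i))) s' := aval (Mem (cell 2 (Reg (2 * i)))) s')) \<and>
        J (fst s', (snd s')(aval (cell (offset j) (Reg (2 * i))) s' := aval (Mem (cell 2 (Reg (2 * i)))) s')) \<and>
        (\<forall>v<r b. snd (fst s', (snd s')(aval (cell (offset j) (Reg (2 * i))) s' := aval (Mem (cell 2 (Reg (2 * i)))) s'))
           (length x + (3 * v + 2)) = val v)"
        using I k c conc_reg[OF c] conc_store[of x "r(i := k)" "M' k" "fst s'" "snd s'" j k "val k"] neq
        by (auto simp: I2_def J_def keep_def M'_Suc)
    next
      fix s3
      assume s3: "conc x (r(i := k)) (M' (Suc k)) s3 \<and> J s3 \<and> (\<forall>v<r b. snd s3 (length x + (3 * v + 2)) = val v)"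
      then have c3: "conc x (r(i := k)) (M' (Suc k)) s3" by simp
      have "I2 (Suc k) ((fst s3)(2 * i := aval (Plus (Reg (2 * i)) (Const 1)) s3), snd s3)"
        using s3 inc[of k "M' (Suc k)" "fst s3" "snd s3"] conc_reg(1)[OF c3, of i]
        by (auto simp: I2_def J_def keep_def)
      then show "runs ?inc s3 1 (I2 (Suc k))"
        by (rule runs_Assign) simp
    qed simp
  qed
  have loop1: "runs (While ?a ?b1) s' (r b * (ecst e B + (1 + 1) + 1) + 1) (I1 (r b))" if "I1 0 s'" for s'
    by (rule runs_While[where I = I1, OF body1 _ that]) (auto simp: I1_def J_def dest!: conc_reg(1)[where i = i])
  have loop2: "runs (While ?a ?b2) s' (r b * (1 + 1 + 1) + 1) (I2 (r b))" if "I2 0 s'" for s'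
    by (rule runs_While[where I = I2, OF body2 _ that]) (auto simp: I2_def J_def dest!: conc_reg(1)[where i = i])
  have sem: "sem x (Fill j i b e) (r, M) = (r, M' (r b))"
    unfolding sem.simps fst_conv snd_conv M'_def val_def ..
  have fin: "runs (Assign (2 * i) (Reg (tmp d))) s' 1 (pspec x d (sem x (Fill j i b e) (r, M)) s)"
    if "I2 (r b) s'" for s'
    using that conc_var[of x "r(i := r b)" "M' (r b)" "fst s'" "snd s'" i "r i"]
    by (intro runs_Assign) (auto simp: I2_def J_def pspec_def keep_def sem simp del: sem.simps)
  have tail: "runs (Seq (Assign (2 * i) (Const 0)) (Seq (While ?a ?b2) (Assign (2 * i) (Reg (tmp d))))) s'
      (r b * (1 + 1 + 1) + 1 + 1 + 1) (pspec x d (sem x (Fill j i b e) (r, M)) s)" if s': "I1 (r b) s'" for s'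
  proof (intro runs_SeqAssign runs_Seq[OF loop2 fin])
    have "M' 0 = M" by (simp add: M'_def)
    then show "I2 0 ((fst s')(2 * i := aval (Const 0) s'), snd s')"
      using s' conc_var[of x "r(i := r b)" M "fst s'" "snd s'" i 0]
      by (auto simp: I2_def I1_def J_def keep_def)
  qed
  have I0: "I1 0 ((fst s)(tmp d := r i, tmp (d + 1) := r b, 2 * i := 0), snd s)"
    using Fill.prems(1) by (auto simp: I1_def J_def keep_def intro!: conc_var)
  have "runs (cprog (Fill j i b e) d) s
    (r b * (ecst e B + (1 + 1) + 1) + 1 + (r b * (1 + 1 + 1) + 1 + 1 + 1) + 1 + 1 + 1)
    (pspec x d (sem x (Fill j i b e) (r, M)) s)"
    unfolding cprog.simps
    by (intro runs_SeqAssign) (use runs_Seq[OF loop1[OF I0] tail] Fill.prems(1) in \<open>simp add: conc_reg\<close>)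
  moreover have "r b * (ecst e B + (1 + 1) + 1) \<le> B * (ecst e B + 3)" "r b * (1 + 1 + 1) \<le> B * 3"
    using Fill.prems(2) by (intro mult_mono; auto)+
  ultimately show ?case
    by (elim runs_mono) auto
qed


section \<open>Ranks and digits\<close>

text \<open>Ranks enumerate a set without storing a list: the machine obtains a rank by one bounded
  sum.\<close>

definition rank :: "nat set \<Rightarrow> nat \<Rightarrow> nat" where
  "rank X v = card {u \<in> X. u < v}"

lemma rank_bij:
  assumes "finite X"
  shows "bij_betw (rank X) X {..<card X}"
proof -
  have less: "rank X u < rank X v" if "u \<in> X" "v \<in> X" "u < v" for u v
    unfolding rank_def by (rule psubset_card_mono) (use that assms in auto)
  have inj: "inj_on (rank X) X"
    by (rule inj_onI) (metis less less_irrefl linorder_neqE_nat)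
  have "rank X ` X \<subseteq> {..<card X}"
  proof clarsimp
    fix v assume "v \<in> X"
    then show "rank X v < card X"
      unfolding rank_def by (intro psubset_card_mono) (use assms in auto)
  qed
  moreover have "card (rank X ` X) = card {..<card X}"
    using inj by (simp add: card_image)
  ultimately have "rank X ` X = {..<card X}"
    by (intro card_subset_eq) auto
  with inj show ?thesis by (simp add: bij_betw_def)
qed

lemma rank_less: "finite X \<Longrightarrow> v \<in> X \<Longrightarrow> rank X v < card X"
  using rank_bij[of X] by (auto simp: bij_betw_def)

text \<open>Decodes a digit into a move: ranks below \<open>card X\<close> give singletons, every
  other digit gives the empty set, on which \<open>toggle\<close> does nothing.\<close>

definition pick :: "nat set \<Rightarrow> nat \<Rightarrow> nat set" where
  "pick X d = {v \<in> X. rank X v = d}"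

definition small :: "'a set \<Rightarrow> 'a set \<Rightarrow> bool" where
  "small W X \<longleftrightarrow> X = {} \<or> (\<exists>v\<in>W. X = {v})"

lemma pick_rank: "finite X \<Longrightarrow> v \<in> X \<Longrightarrow> pick X (rank X v) = {v}"
  using rank_bij[of X] by (auto simp: pick_def bij_betw_def inj_on_def)

lemma small_pick: "finite X \<Longrightarrow> small X (pick X d)"
  unfolding small_def using pick_rank by (fastforce simp: pick_def)

lemma ex_pick:
  assumes "finite W" "small W X"
  shows "\<exists>d < card W + 1. X = pick W d"
proof (cases "X = {}")
  case True
  have "pick W (card W) = {}"
    using rank_less[OF assms(1)] by (fastforce simp: pick_def)
  then show ?thesis using True by auto
next
  case False
  with assms obtain v where "v \<in> W" "X = {v}" by (auto simp: small_def)
  then show ?thesis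
    using pick_rank[of W v] rank_less[of W v] assms(1) by (metis less_Suc_eq Suc_eq_plus1)
qed

definition firsts :: "nat \<Rightarrow> nat set \<Rightarrow> nat set" where
  "firsts N X = {v \<in> X. rank X v < N}"

lemma card_firsts:
  assumes "finite X"
  shows "card (firsts N X) = min N (card X)"
proof -
  have bij: "inj_on (rank X) X" "rank X ` X = {..<card X}"
    using rank_bij[OF assms] by (auto simp: bij_betw_def)
  have "rank X ` firsts N X = {..<min N (card X)}"
  proof -
    have "rank X ` firsts N X = rank X ` X \<inter> {..<N}" by (auto simp: firsts_def)
    then show ?thesis using bij(2) by auto
  qed
  moreover have "inj_on (rank X) (firsts N X)"
    using bij(1) by (rule inj_on_subset) (auto simp: firsts_def)
  ultimately show ?thesis by (metis card_image card_lessThan)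
qed

lemma firsts_eq:
  assumes "finite X" "card (firsts N X) < N"
  shows "firsts N X = X"
  using assms card_firsts[of X N] by (intro card_subset_eq) (auto simp: firsts_def min_def split: if_splits)

lemma ex_digits:
  fixes b :: nat
  assumes "0 < b" "\<And>j. j < T \<Longrightarrow> g j < b"
  shows "\<exists>c < b ^ T. \<forall>j<T. c div b ^ j mod b = g j"
  using assms(2)
proof (induction T arbitrary: g)
  case (Suc T)
  from Suc.IH[of "\<lambda>j. g (Suc j)"] Suc.prems obtain c where
    c: "c < b ^ T" "\<forall>j<T. c div b ^ j mod b = g (Suc j)" by auto
  have g0: "g 0 < b" using Suc.prems by simp
  \<comment> \<open>The number is built from its least significant digit; dividing by
    \<open>b\<close> once matches the shift of \<open>g\<close>.\<close>
  have "(b * c + g 0) div b ^ j mod b = g j" if "j < Suc T" for j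
  proof (cases j)
    case (Suc i)
    have "(b * c + g 0) div b ^ j = c div b ^ i"
      using g0 Suc by (simp add: div_mult2_eq)
    then show ?thesis using c that Suc by simp
  qed (use g0 in simp)
  moreover have "b * c + g 0 < b ^ Suc T"
  proof -
    have "b * c + g 0 < b * (c + 1)" using g0 by simp
    also have "\<dots> \<le> b * b ^ T" using c(1) by (intro mult_left_mono) auto
    finally show ?thesis by simp
  qed
  ultimately show ?case by blast
qed simp


section \<open>Confining a reconfiguration sequence\<close>

definition toggle :: "'a set \<Rightarrow> 'a set \<Rightarrow> 'a set" where
  "toggle A X = (A - X) \<union> (X - A)"

text \<open>The degree filter applies to the added vertices only. Without it a second round could
  explode, since a neighbour of a low-degree vertex may have any degree; the degrees in
  \<open>S\<close> are controlled separately.\<close>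

definition near :: "('a \<times> 'a) set \<Rightarrow> nat \<Rightarrow> 'a set \<Rightarrow> 'a set" where
  "near E D S = S \<union> {v \<in> E `` S. card (E `` {v}) \<le> D}"

lemma card_Diff_sym:
  assumes "finite A" "finite B" "card A = card B"
  shows "card (A - B) = card (B - A)"
  using assms by (simp add: card_Diff_subset_Int Int_commute)

locale graph =
  fixes V :: "'a set" and E :: "('a \<times> 'a) set"
  assumes simple: "simple_graph V E"
begin

lemma finite_V: "finite V" and E_sub: "(u, v) \<in> E \<Longrightarrow> u \<in> V \<and> v \<in> V"
  and E_sym: "(u, v) \<in> E \<Longrightarrow> (v, u) \<in> E" and E_irrefl: "(v, v) \<notin> E"
  using simple by (auto simp: simple_graph_def sym_def irrefl_def)

lemma finite_nbh [simp]: "finite (E `` S)"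
  by (rule finite_subset[OF _ finite_V]) (auto dest: E_sub)

abbreviation "DA \<equiv> defensive_alliance V E"

lemma DA_sub: "DA A \<Longrightarrow> A \<subseteq> V"
  by (simp add: defensive_alliance_def)

lemma DA_finite: "DA A \<Longrightarrow> finite A"
  using finite_subset[OF DA_sub finite_V] .

lemma deg_split: "deg_in E A v + deg_in E (V - A) v = card (E `` {v})"
  unfolding deg_in_def
  by (subst card_Un_disjoint[symmetric]) (auto intro!: arg_cong[where f = card] dest: E_sub)

text \<open>At most \<open>k\<close> neighbours lie inside the alliance, hence at most
  \<open>k + 1\<close> outside.\<close>

lemma DA_degree:
  assumes "DA A" "v \<in> A" "card A \<le> k"
  shows "card (E `` {v}) \<le> 2 * k + 1"
proof -
  have "deg_in E A v \<le> card A"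
    unfolding deg_in_def by (intro card_mono DA_finite[OF assms(1)]) auto
  then show ?thesis
    using assms deg_split[of A v] by (auto simp: defensive_alliance_def)
qed

text \<open>Vertices of \<open>A \<inter> K\<close> keep all their neighbours in \<open>A\<close>;
  as the total degree is fixed, the number of outside neighbours does not change either.\<close>

lemma DA_restrict:
  assumes "DA A" "\<And>v. v \<in> A \<inter> K \<Longrightarrow> E `` {v} \<inter> A \<subseteq> K"
  shows "DA (A \<inter> K)"
  unfolding defensive_alliance_def
proof (intro conjI ballI)
  fix v assume v: "v \<in> A \<inter> K"
  with assms(2) have "deg_in E (A \<inter> K) v = deg_in E A v"
    unfolding deg_in_def by (intro arg_cong[where f = card]) blast
  with v assms(1) show "deg_in E (V - A \<inter> K) v \<le> deg_in E (A \<inter> K) v + 1"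
    using deg_split[of A v] deg_split[of "A \<inter> K" v] by (auto simp: defensive_alliance_def)
qed (use DA_sub[OF assms(1)] in auto)

definition leaves :: "'a set" where
  "leaves = {v \<in> V. card (E `` {v}) \<le> 1}"

text \<open>Old members can only gain allied neighbours, and the single neighbour a leaf may have is
  tolerated by the \<open>+ 1\<close> in the alliance condition.\<close>

lemma DA_leaves:
  assumes "DA A" "L \<subseteq> leaves"
  shows "DA (A \<union> L)"
  unfolding defensive_alliance_def
proof (intro conjI ballI)
  fix v assume v: "v \<in> A \<union> L"
  have "deg_in E A v \<le> deg_in E (A \<union> L) v"
    unfolding deg_in_def by (rule card_mono) auto
  with v assms show "deg_in E (V - (A \<union> L)) v \<le> deg_in E (A \<union> L) v + 1"
    using deg_split[of A v] deg_split[of "A \<union> L" v]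
    by (auto simp: defensive_alliance_def leaves_def)
qed (use DA_sub[OF assms(1)] assms(2) in \<open>auto simp: leaves_def\<close>)

lemma card_near:
  assumes "finite S" "\<And>v. v \<in> S \<Longrightarrow> card (E `` {v}) \<le> D"
  shows "card (near E D S) \<le> card S * (D + 1)"
proof -
  have "near E D S \<subseteq> (\<Union>u\<in>S. insert u (E `` {u}))"
    by (auto simp: near_def)
  then have "card (near E D S) \<le> card (\<Union>u\<in>S. insert u (E `` {u}))"
    using assms(1) by (intro card_mono) auto
  also have "\<dots> \<le> (\<Sum>u\<in>S. card (insert u (E `` {u})))"
    by (rule card_UN_le[OF assms(1)])
  also have "\<dots> \<le> (\<Sum>u\<in>S. D + 1)"
    by (rule sum_mono) (use assms(2) in \<open>simp add: card_insert_if le_SucI\<close>)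
  finally show ?thesis by simp
qed

lemma near_iterate:
  assumes "finite S" "\<And>v. v \<in> S \<Longrightarrow> card (E `` {v}) \<le> D"
  shows "finite ((near E D ^^ j) S) \<and> (\<forall>v \<in> (near E D ^^ j) S. card (E `` {v}) \<le> D) \<and>
    card ((near E D ^^ j) S) \<le> card S * (D + 1) ^ j"
proof (induction j)
  case (Suc j)
  let ?N = "(near E D ^^ j) S"
  have "card (near E D ?N) \<le> card ?N * (D + 1)"
    using Suc by (intro card_near) auto
  also have "\<dots> \<le> card S * (D + 1) ^ j * (D + 1)"
    using Suc by (intro mult_right_mono) auto
  finally have "card (near E D ?N) \<le> card S * (D + 1) ^ Suc j" by (simp only: power_Suc2 mult.assoc)
  moreover have "finite (near E D ?N) \<and> (\<forall>v \<in> near E D ?N. card (E `` {v}) \<le> D)"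
    using Suc.IH unfolding near_def[of E D ?N] by auto
  ultimately show ?case by simp
qed (use assms in auto)

lemma near_funpow_sub: "S \<subseteq> V \<Longrightarrow> (near E D ^^ j) S \<subseteq> V"
  by (induction j) (auto simp: near_def dest: E_sub)

lemma near_funpow_incr: "S \<subseteq> (near E D ^^ j) S"
  by (induction j) (auto simp: near_def)

text \<open>Every step brings in at most one new vertex, whence \<open>k + m\<close>.
  \<open>K\<close> is what can be reached from \<open>Z\<close> inside \<open>U\<close>; the degree
  filter of \<open>near\<close> never blocks this, because each vertex of \<open>U\<close> belongs
  to an alliance of size at most \<open>k\<close>.\<close>

lemma confine:
  assumes p: "k + m \<le> p"
    and A: "\<And>i. i \<le> m \<Longrightarrow> DA (A i) \<and> card (A i) \<le> k"
    and step: "\<And>i. i < m \<Longrightarrow> card (A (Suc i) - A i) \<le> 1"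
  defines "U \<equiv> \<Union>i\<le>m. A i"
  shows "card U \<le> p" and "finite U"
    and "\<exists>K. Z \<inter> U \<subseteq> K \<and> K \<subseteq> U \<and> K \<subseteq> (near E (2 * p + 1) ^^ p) Z \<and> E `` K \<inter> U \<subseteq> K"
proof -
  have "finite (\<Union>i\<le>j. A i) \<and> card (\<Union>i\<le>j. A i) \<le> k + j" if "j \<le> m" for j
    using that
  proof (induction j)
    case 0
    then show ?case using A[of 0] DA_finite by simp
  next
    case (Suc j)
    have "(\<Union>i\<le>Suc j. A i) = (\<Union>i\<le>j. A i) \<union> (A (Suc j) - A j)"
      by (auto simp: le_Suc_eq)
    moreover have "card ((\<Union>i\<le>j. A i) \<union> (A (Suc j) - A j)) \<le> (k + j) + 1"
      using Suc step[of j] by (intro order_trans[OF card_Un_le] add_mono) auto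
    ultimately show ?case using Suc A[of "Suc j"] DA_finite by auto
  qed
  from this[of m] show U: "card U \<le> p" "finite U" using p by (auto simp: U_def)
  define G where "G = (\<lambda>S. S \<union> E `` S \<inter> U)"
  define K where "K = (G ^^ p) (Z \<inter> U)"
  have sub: "(G ^^ j) (Z \<inter> U) \<subseteq> U" for j
    by (induction j) (auto simp: G_def)
  \<comment> \<open>A round that changes something adds a vertex, so a set still unstable at stage
    \<open>j\<close> has at least \<open>j\<close> elements. At stage \<open>p\<close> it would be
    all of \<open>U\<close>, which is stable.\<close>
  have "G ((G ^^ j) (Z \<inter> U)) = (G ^^ j) (Z \<inter> U) \<or> j \<le> card ((G ^^ j) (Z \<inter> U))" for j
  proof (induction j)
    case (Suc j)
    show ?case
    proof (cases "G ((G ^^ j) (Z \<inter> U)) = (G ^^ j) (Z \<inter> U)")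
      case False
      have fin: "finite ((G ^^ Suc j) (Z \<inter> U))"
        using sub U(2) by (rule finite_subset)
      have "(G ^^ j) (Z \<inter> U) \<subset> (G ^^ Suc j) (Z \<inter> U)"
        using False by (auto simp: G_def)
      from psubset_card_mono[OF fin this] Suc False show ?thesis by linarith
    qed simp
  qed simp
  then have "G K = K"
  proof (rule disjE)
    assume "p \<le> card ((G ^^ p) (Z \<inter> U))"
    then have "K = U"
      unfolding K_def using U sub[of p] card_mono[OF U(2) sub[of p]] by (intro card_subset_eq) auto
    then show ?thesis by (auto simp: G_def)
  qed (simp add: K_def)
  then have cl: "E `` K \<inter> U \<subseteq> K" by (auto simp: G_def)
  have deg: "card (E `` {v}) \<le> 2 * p + 1" if "v \<in> U" for v
    proof -
    obtain i where "i \<le> m" "v \<in> A i" using \<open>v \<in> U\<close> by (auto simp: U_def)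
    with A[of i] DA_degree[of "A i" v k] p show ?thesis by auto
  qed
  have "(G ^^ j) (Z \<inter> U) \<subseteq> (near E (2 * p + 1) ^^ j) Z" for j
  proof (induction j)
    case (Suc j)
    then show ?case using deg by (auto simp: G_def near_def)
  qed simp
  then have "K \<subseteq> (near E (2 * p + 1) ^^ p) Z" by (simp add: K_def)
  moreover have "Z \<inter> U \<subseteq> (G ^^ j) (Z \<inter> U)" for j
    by (induction j) (auto simp: G_def)
  ultimately show "\<exists>K. Z \<inter> U \<subseteq> K \<and> K \<subseteq> U \<and> K \<subseteq> (near E (2 * p + 1) ^^ p) Z \<and> E `` K \<inter> U \<subseteq> K"
    using cl sub by (intro exI[of _ K]) (auto simp: K_def)
qed

text \<open>Alliances and toggled sets are both intersected with \<open>K\<close>, so a move outside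
  \<open>K\<close> turns into an idle one. The endpoints survive since they lie in \<open>Z\<close>
  and hence in \<open>K\<close>. Sizes can only drop, which suffices here but not for token
  jumping.\<close>

lemma confine_tar:
  assumes p: "k + m \<le> p"
    and A: "\<And>i. i \<le> m \<Longrightarrow> DA (A i) \<and> card (A i) \<le> k"
    and step: "\<And>i. i < m \<Longrightarrow> \<exists>X. small UNIV X \<and> A (Suc i) = toggle (A i) X"
    and Z: "A 0 \<subseteq> Z" "A m \<subseteq> Z"
  shows "\<exists>B. B 0 = A 0 \<and> B m = A m \<and> (\<forall>i\<le>m. DA (B i) \<and> card (B i) \<le> k) \<and>
     (\<forall>i<m. \<exists>X. small ((near E (2 * p + 1) ^^ p) Z) X \<and> B (Suc i) = toggle (B i) X)"
proof -
  let ?U = "\<Union>i\<le>m. A i"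
  have "card (A (Suc i) - A i) \<le> 1" if i: "i < m" for i
  proof -
    obtain X where X: "small UNIV X" "A (Suc i) = toggle (A i) X" using step[OF i] by blast
    then have "card (A (Suc i) - A i) \<le> card X"
      by (intro card_mono) (auto simp: small_def toggle_def)
    also have "\<dots> \<le> 1" using X by (auto simp: small_def)
    finally show ?thesis .
  qed
  from confine(3)[where A = A, OF p A this, of Z] obtain K where
    K: "Z \<inter> ?U \<subseteq> K" "K \<subseteq> (near E (2 * p + 1) ^^ p) Z" "E `` K \<inter> ?U \<subseteq> K" by auto
  show ?thesis
  proof (rule exI[of _ "\<lambda>i. A i \<inter> K"], intro conjI allI impI)
    show "A 0 \<inter> K = A 0" "A m \<inter> K = A m" using Z K(1) by auto
    fix i assume i: "i \<le> m"
    show "DA (A i \<inter> K)"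
      by (rule DA_restrict) (use A i K(3) in auto)
    show "card (A i \<inter> K) \<le> k"
      using A[OF i] card_mono[of "A i" "A i \<inter> K"] DA_finite by fastforce
  next
    fix i assume "i < m"
    then obtain X where X: "small UNIV X" "A (Suc i) = toggle (A i) X" using step by blast
    then have "small ((near E (2 * p + 1) ^^ p) Z) (X \<inter> K)"
      using K(2) by (auto simp: small_def)
    moreover have "A (Suc i) \<inter> K = toggle (A i \<inter> K) (X \<inter> K)"
      using X(2) by (auto simp: toggle_def)
    ultimately show "\<exists>X. small ((near E (2 * p + 1) ^^ p) Z) X \<and> A (Suc i) \<inter> K = toggle (A i \<inter> K) X"
      by blast
  qed
qed

text \<open>A jump from \<open>x\<close> to \<open>y\<close> removes \<open>x\<close> and then adds
  \<open>y\<close>; nothing is demanded of the set in between.\<close>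

lemma toggle_twice:
  assumes "finite B" "finite B'" "card B = card B'" "card (B' - B) \<le> 1" "B \<subseteq> W" "B' \<subseteq> W"
  shows "\<exists>X Y. small W X \<and> small W Y \<and> B' = toggle (toggle B X) Y"
proof (cases "B' - B = {}")
  case True
  then have "B' = B" using assms by (intro card_subset_eq) auto
  then show ?thesis by (intro exI[of _ "{}"]) (auto simp: small_def toggle_def)
next
  case False
  moreover have "card (B - B') = card (B' - B)"
    by (rule card_Diff_sym[OF assms(1-3)])
  moreover have "card (B' - B) \<noteq> 0" using False assms(2) by simp
  ultimately have "card (B' - B) = 1" "card (B - B') = 1" using assms(4) by auto
  then obtain x y where "B' - B = {y}" "B - B' = {x}" by (auto simp: card_1_singleton_iff)
  then show ?thesis using assms(5,6)
    by (intro exI[of _ "{x}"] exI[of _ "{y}"]) (auto simp: small_def toggle_def)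
qed

text \<open>
  Tokens outside \<open>K\<close> are parked on a pool of leaves instead: leaves never violate the alliance
  condition, wherever they are. If the pool is too small for this, then it contains all leaves, and
  since a token can only enter away from its neighbours on a leaf, nothing ever leaves \<open>K\<close>.
\<close>

lemma confine_tj:
  assumes p: "k + m \<le> p"
    and A: "\<And>i. i \<le> m \<Longrightarrow> DA (A i) \<and> card (A i) = k"
    and step: "\<And>i. i < m \<Longrightarrow> card (A (Suc i) - A i) \<le> 1"
    and Z: "A 0 \<subseteq> Z" "A m \<subseteq> Z"
    and T: "T \<subseteq> leaves" "T \<subseteq> Z" "T = leaves \<or> 2 * p \<le> card T"
  shows "\<exists>B. B 0 = A 0 \<and> B m = A m \<and> (\<forall>i\<le>m. DA (B i) \<and> card (B i) = k) \<and>
     (\<forall>i\<le>m. B i \<subseteq> (near E (2 * p + 1) ^^ p) Z) \<and> (\<forall>i<m. card (B (Suc i) - B i) \<le> 1)"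
proof -
  let ?U = "\<Union>i\<le>m. A i"
  have A': "DA (A i) \<and> card (A i) \<le> k" if "i \<le> m" for i using A that by auto
  note U = confine(1,2)[where A = A, OF p A' step]
  from confine(3)[where A = A, OF p A' step, of Z] obtain K where
    K: "Z \<inter> ?U \<subseteq> K" "K \<subseteq> (near E (2 * p + 1) ^^ p) Z" "E `` K \<inter> ?U \<subseteq> K" by auto
  show ?thesis
  proof (cases "\<forall>i\<le>m. A i \<subseteq> K")
    case True
    then show ?thesis using A step K(2) by (intro exI[of _ A]) blast
  next
    case False
    define i where "i = (LEAST i. i \<le> m \<and> \<not> A i \<subseteq> K)"
    have i: "i \<le> m" "\<not> A i \<subseteq> K"
      using False LeastI_ex[of "\<lambda>i. i \<le> m \<and> \<not> A i \<subseteq> K"] by (auto simp: i_def)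
    have "A 0 \<subseteq> K" using Z(1) K(1) by auto
    with i obtain j where j: "i = Suc j" by (cases i) auto
    have Aj: "A j \<subseteq> K"
      using not_less_Least[of j "\<lambda>i. i \<le> m \<and> \<not> A i \<subseteq> K"] i(1) j by (auto simp: i_def)
    from i obtain v where v: "v \<in> A i" "v \<notin> K" by auto
    have fin: "finite (A i - A j)" using A[OF i(1)] DA_finite by auto
    have new: "A i - A j = {v}"
      using step[of j] i(1) j v Aj fin by (intro card_seteq[symmetric]) auto
    \<comment> \<open>\<open>i\<close> is the first index at which \<open>K\<close> is left, so all
      other members of \<open>A i\<close> lie in \<open>K\<close>, and an allied neighbour of
      \<open>v\<close> would pull \<open>v\<close> into \<open>K\<close>. Without allied neighbours,
      \<open>v\<close> has degree at most 1.\<close>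
    have "E `` {v} \<inter> A i = {}"
    proof (rule ccontr)
      assume "E `` {v} \<inter> A i \<noteq> {}"
      then obtain u where u: "(v, u) \<in> E" "u \<in> A i" by auto
      moreover from u(1) E_irrefl have "u \<noteq> v" by auto
      ultimately have "u \<in> K" using new Aj by blast
      with u(1) E_sym have "v \<in> E `` K" by blast
      with K(3) v i(1) show False by blast
    qed
    then have "deg_in E (A i) v = 0" by (simp add: deg_in_def)
    with A[OF i(1)] v(1) deg_split[of "A i" v] have "v \<in> leaves"
      by (auto simp: defensive_alliance_def leaves_def)
    \<comment> \<open>\<open>v\<close> is a leaf outside \<open>T\<close>, so \<open>T\<close> is
      not all of \<open>leaves\<close> and must have \<open>2 * p\<close> elements; at most
      \<open>p\<close> of them are lost to \<open>U\<close>.\<close>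
    moreover have "v \<notin> T" using K(1) T(2) v i(1) by blast
    ultimately have "2 * p \<le> card T" using T(3) by blast
    moreover have "card T - card ?U \<le> card (T - ?U)"
      by (rule diff_card_le_card_Diff[OF U(2)])
    ultimately have "p \<le> card (T - ?U)" using U(1) by linarith
    then obtain P where P: "P \<subseteq> T - ?U" "card P = p" "finite P"
      by (rule obtain_subset_with_card_n)
    obtain xs where xs: "set xs = P" "distinct xs" using finite_distinct_list[OF P(3)] by blast
    have len: "length xs = p" using xs P(2) distinct_card by force
    define c where "c = (\<lambda>i. card (A i - K))"
    \<comment> \<open>Prefixes of one fixed list make the parked sets nested, so consecutive ones
      differ only by the change of \<open>c\<close>.\<close>
    define B where "B = (\<lambda>i. (A i \<inter> K) \<union> set (take (c i) xs))"
    have take_P: "set (take j xs) \<subseteq> P" for j using xs(1) set_take_subset by fast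
    have finA: "finite (A i)" if "i \<le> m" for i using A[OF that] DA_finite by auto
    have cle: "c i \<le> p" if "i \<le> m" for i
    proof -
      have "c i \<le> card (A i)" unfolding c_def using finA[OF that] by (intro card_mono) auto
      then show ?thesis using A[OF that] p by simp
    qed
    have cardB: "card (B i) = k" if i: "i \<le> m" for i
    proof -
      have "card (B i) = card (A i \<inter> K) + card (set (take (c i) xs))"
        unfolding B_def using finA[OF i] take_P[of "c i"] P(1) i by (intro card_Un_disjoint) auto
      also have "card (set (take (c i) xs)) = c i"
        using xs(2) cle[OF i] len by (simp add: distinct_card)
      also have "card (A i \<inter> K) + c i = card (A i)"
        unfolding c_def using finA[OF i] by (subst card_Un_disjoint[symmetric]) (auto intro: arg_cong[where f = card])
      finally show ?thesis using A[OF i] by simp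
    qed
    show ?thesis
    proof (rule exI[of _ B], intro conjI allI impI)
      show "B 0 = A 0" "B m = A m"
      proof -
        have "A 0 - K = {}" "A m - K = {}" "A 0 \<inter> K = A 0" "A m \<inter> K = A m" using Z K(1) by blast+
        moreover from this have "c 0 = 0" "c m = 0" by (simp_all only: c_def card.empty)
        ultimately show "B 0 = A 0" "B m = A m" by (simp_all add: B_def)
      qed
    next
      fix i assume i: "i \<le> m"
      have "DA (A i \<inter> K)" by (rule DA_restrict) (use A i K(3) in auto)
      then show "DA (B i)"
        unfolding B_def by (rule DA_leaves) (use take_P P(1) T(1) in blast)
      show "card (B i) = k" by (rule cardB[OF i])
      have "P \<subseteq> (near E (2 * p + 1) ^^ p) Z"
        by (rule order_trans[OF _ near_funpow_incr]) (use P(1) T(2) in blast)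
      then show "B i \<subseteq> (near E (2 * p + 1) ^^ p) Z"
        using take_P[of "c i"] K(2) by (auto simp: B_def)
    next
      fix i assume i: "i < m"
      have fin: "finite (A (Suc i) - A i)" using finA[of "Suc i"] i by simp
      \<comment> \<open>If \<open>c\<close> does not grow, no parking place is newly used. If it
        grows, then by one, and the vertex entering \<open>A (Suc i)\<close> lies outside
        \<open>K\<close>; the next leaf of the list is then the only new element.\<close>
      show "card (B (Suc i) - B i) \<le> 1"
      proof (cases "c (Suc i) \<le> c i")
        case True
        then have "set (take (c (Suc i)) xs) \<subseteq> set (take (c i) xs)"
          by (rule set_take_subset_set_take)
        then have "B (Suc i) - B i \<subseteq> A (Suc i) - A i" by (auto simp: B_def)
        then show ?thesis using step[OF i] card_mono[OF fin] le_trans by blast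
      next
        case False
        have "A (Suc i) - K \<subseteq> (A i - K) \<union> (A (Suc i) - A i)" by auto
        then have "c (Suc i) \<le> card ((A i - K) \<union> (A (Suc i) - A i))"
          unfolding c_def using finA[of i] i fin by (intro card_mono) auto
        also have "\<dots> \<le> c i + card (A (Suc i) - A i)"
          unfolding c_def by (rule card_Un_le)
        finally have c: "c (Suc i) = Suc (c i)" using False step[OF i] by linarith
        have "\<not> A (Suc i) - K \<subseteq> A i - K"
        proof
          assume "A (Suc i) - K \<subseteq> A i - K"
          then have "c (Suc i) \<le> c i" unfolding c_def using finA[of i] i by (intro card_mono) auto
          with False show False by simp
        qed
        then obtain y where y: "y \<in> A (Suc i) - A i" "y \<notin> K" by auto
        have "A (Suc i) - A i = {y}"
          using step[OF i] y fin by (intro card_seteq[symmetric]) auto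
        with y have "A (Suc i) \<inter> K \<subseteq> A i \<inter> K" by auto
        moreover have "set (take (c (Suc i)) xs) = insert (xs ! c i) (set (take (c i) xs))"
          using cle[of "Suc i"] i len c by (simp add: take_Suc_conv_app_nth)
        ultimately have "B (Suc i) - B i \<subseteq> {xs ! c i}" by (auto simp: B_def)
        then show ?thesis using card_mono[of "{xs ! c i}"] by fastforce
      qed
    qed
  qed
qed

end

section \<open>Reconfiguration sequences as sequences of moves\<close>

primrec toggles :: "'a set \<Rightarrow> (nat \<Rightarrow> 'a set) \<Rightarrow> nat \<Rightarrow> 'a set" where
  "toggles A X 0 = A"
| "toggles A X (Suc j) = toggle (toggles A X j) (X j)"

text \<open>Repeating the last set pads a list of length at most \<open>l\<close> to exactly
  \<open>l - 1\<close> steps, some of them idle, so that a loop of fixed length can check it;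
  conversely idle steps are dropped. A nonempty list forces \<open>1 \<le> l\<close>.\<close>

lemma successively_stutter:
  "(\<exists>S. S \<noteq> [] \<and> hd S = a \<and> last S = z \<and> length S \<le> l \<and> (\<forall>A\<in>set S. P A) \<and> successively R S) \<longleftrightarrow>
   1 \<le> l \<and> (\<exists>A. A 0 = a \<and> A (l - 1) = z \<and> (\<forall>i\<le>l - 1. P (A i)) \<and>
     (\<forall>i<l - 1. A (Suc i) = A i \<or> R (A i) (A (Suc i))))" (is "?L \<longleftrightarrow> ?R")
proof
  assume ?L
  then obtain S where S: "S \<noteq> []" "hd S = a" "last S = z" "length S \<le> l" "\<forall>A\<in>set S. P A"
    "successively R S" by blast
  define A where "A = (\<lambda>i. S ! min i (length S - 1))"
  have pos: "0 < length S" using S(1) by simp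
  have "A 0 = a" using S(1,2) by (simp add: A_def hd_conv_nth)
  moreover have "A (l - 1) = z"
    using S(1,3,4) by (simp add: A_def last_conv_nth min_absorb2)
  moreover have "P (A i)" for i
    unfolding A_def by (rule bspec[OF S(5)], rule nth_mem) (use pos in linarith)
  moreover have "A (Suc i) = A i \<or> R (A i) (A (Suc i))" for i
  proof (cases "Suc i < length S")
    case True
    then have "R (S ! i) (S ! Suc i)" using S(6) by (auto simp: successively_conv_nth)
    with True show ?thesis by (simp add: A_def)
  next
    case False
    then have "min (Suc i) (length S - 1) = min i (length S - 1)" by linarith
    then show ?thesis by (simp add: A_def)
  qed
  moreover have "1 \<le> l" using S(4) pos by linarith
  ultimately show ?R by blast
next
  assume ?R
  then obtain A where l: "1 \<le> l" and A: "A 0 = a" "A (l - 1) = z" "\<forall>i\<le>l - 1. P (A i)"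
    "\<forall>i<l - 1. A (Suc i) = A i \<or> R (A i) (A (Suc i))" by blast
  have "\<exists>S. S \<noteq> [] \<and> hd S = a \<and> last S = A m \<and> length S \<le> Suc m \<and> (\<forall>A\<in>set S. P A) \<and> successively R S"
    if "m \<le> l - 1" for m
    using that
  proof (induction m)
    case 0
    then show ?case using A(1,3) by (intro exI[of _ "[a]"]) auto
  next
    case (Suc m)
    then obtain S where S: "S \<noteq> []" "hd S = a" "last S = A m" "length S \<le> Suc m" "\<forall>A\<in>set S. P A"
      "successively R S" by auto
    from A(4) Suc.prems have "A (Suc m) = A m \<or> R (A m) (A (Suc m))" by simp
    then show ?case
    proof
      assume "A (Suc m) = A m"
      with S show ?thesis by (intro exI[of _ S]) auto
    next
      assume "R (A m) (A (Suc m))"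
      with S Suc.prems A(3) show ?thesis
        by (intro exI[of _ "S @ [A (Suc m)]"]) (auto simp: successively_append_iff)
    qed
  qed
  from this[of "l - 1"] l A(2) show ?L by auto
qed

definition card_ok :: "bool \<Rightarrow> nat \<Rightarrow> 'a set \<Rightarrow> bool" where
  "card_ok tj k A \<longleftrightarrow> (if tj then card A = k else card A \<le> k)"

definition reconfigurable where
  "reconfigurable tj V E As At k l =
     (if tj then tj_reconfigurable V E As At l else tar_reconfigurable V E As At k l)"

text \<open>The number of toggles that make up one step.\<close>

definition width :: "bool \<Rightarrow> nat" where
  "width tj = (if tj then 2 else 1)"

context graph
begin

lemma reconfigurable_tar:
  assumes "DA As" "DA At" "card As \<le> k" "card At \<le> k" "k + l = p" "As \<union> At \<subseteq> Z"
  shows "tar_reconfigurable V E As At k l \<longleftrightarrow> 1 \<le> l \<and> (\<exists>X.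
    (\<forall>j<l - 1. small ((near E (2 * p + 1) ^^ p) Z) (X j)) \<and>
    (\<forall>i\<le>l - 1. DA (toggles As X i) \<and> card (toggles As X i) \<le> k) \<and> toggles As X (l - 1) = At)"
    (is "_ \<longleftrightarrow> 1 \<le> l \<and> ?R")
  unfolding tar_reconfigurable_def successively_stutter
proof (intro conj_cong refl iffI)
  assume l: "1 \<le> l"
  assume "\<exists>A. A 0 = As \<and> A (l - 1) = At \<and> (\<forall>i\<le>l - 1. DA (A i) \<and> card (A i) \<le> k) \<and>
     (\<forall>i<l - 1. A (Suc i) = A i \<or> tar_step (A i) (A (Suc i)))"
  then obtain A where A: "A 0 = As" "A (l - 1) = At" "\<And>i. i \<le> l - 1 \<Longrightarrow> DA (A i) \<and> card (A i) \<le> k"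
    "\<And>i. i < l - 1 \<Longrightarrow> A (Suc i) = A i \<or> tar_step (A i) (A (Suc i))" by blast
  have "\<exists>X. small UNIV X \<and> A (Suc i) = toggle (A i) X" if "i < l - 1" for i
    using A(4)[OF that]
  proof
    assume "A (Suc i) = A i"
    then show ?thesis by (intro exI[of _ "{}"]) (simp add: small_def toggle_def)
  next
    assume "tar_step (A i) (A (Suc i))"
    then obtain v where "v \<notin> A i \<and> A (Suc i) = insert v (A i) \<or> v \<notin> A (Suc i) \<and> A i = insert v (A (Suc i))"
      by (auto simp: tar_step_def)
    then show ?thesis by (intro exI[of _ "{v}"]) (auto simp: small_def toggle_def)
  qed
  from confine_tar[where A = A and k = k and m = "l - 1" and p = p and Z = Z, OF _ A(3) this] A(1,2) assms(5,6)
  obtain B where B: "B 0 = As" "B (l - 1) = At" "\<forall>i\<le>l - 1. DA (B i) \<and> card (B i) \<le> k"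
    "\<forall>i<l - 1. \<exists>X. small ((near E (2 * p + 1) ^^ p) Z) X \<and> B (Suc i) = toggle (B i) X" by auto
  from B(4) obtain X where X: "\<And>i. i < l - 1 \<Longrightarrow> small ((near E (2 * p + 1) ^^ p) Z) (X i) \<and> B (Suc i) = toggle (B i) (X i)"
    by metis
  have "toggles As X i = B i" if "i \<le> l - 1" for i
    using that by (induction i) (auto simp: B(1) X)
  with B X show ?R by (intro exI[of _ X]) auto
next
  assume ?R
  then obtain X where X: "\<And>j. j < l - 1 \<Longrightarrow> small ((near E (2 * p + 1) ^^ p) Z) (X j)"
    "\<forall>i\<le>l - 1. DA (toggles As X i) \<and> card (toggles As X i) \<le> k" "toggles As X (l - 1) = At" by blast
  have "toggle A Y = A \<or> tar_step A (toggle A Y)" if "small ((near E (2 * p + 1) ^^ p) Z) Y" for A Y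
  proof (cases "Y = {}")
    case False
    with that obtain v where "Y = {v}" by (auto simp: small_def)
    then have "v \<notin> A \<and> toggle A Y = insert v A \<or> v \<notin> toggle A Y \<and> A = insert v (toggle A Y)"
      by (auto simp: toggle_def)
    then show ?thesis by (auto simp: tar_step_def)
  qed (simp add: toggle_def)
  with X show "\<exists>A. A 0 = As \<and> A (l - 1) = At \<and> (\<forall>i\<le>l - 1. DA (A i) \<and> card (A i) \<le> k) \<and>
     (\<forall>i<l - 1. A (Suc i) = A i \<or> tar_step (A i) (A (Suc i)))"
    by (intro exI[of _ "toggles As X"]) simp
qed

text \<open>Equal sizes make \<open>A - B\<close> and \<open>B - A\<close> equinumerous, so jumping
  and staying put are together the condition that at most one vertex enters.\<close>

lemma tj_step_card:
  assumes "finite A" "finite B" "card A = card B"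
  shows "A = B \<or> tj_step A B \<longleftrightarrow> card (B - A) \<le> 1"
proof -
  have "card (A - B) = card (B - A)"
    using assms by (rule card_Diff_sym)
  moreover have "card (A - B) = 0 \<Longrightarrow> A = B"
    using assms by (intro card_subset_eq) auto
  ultimately show ?thesis using assms(3) by (auto simp: tj_step_def)
qed

text \<open>Sets at odd positions are half-finished jumps and remain unconstrained. This admits
  nothing illegal: two toggles change at most two vertices, and between sets of equal size the
  change splits evenly into leaving and entering vertices.\<close>

lemma reconfigurable_tj:
  assumes "DA As" "DA At" "card As = k" "card At = k" "k + l = p" "As \<union> At \<subseteq> Z" "Z \<subseteq> V"
    and T: "T \<subseteq> leaves" "T \<subseteq> Z" "T = leaves \<or> 2 * p \<le> card T"
  shows "tj_reconfigurable V E As At l \<longleftrightarrow> 1 \<le> l \<and> (\<exists>X.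
    (\<forall>j<2 * (l - 1). small ((near E (2 * p + 1) ^^ p) Z) (X j)) \<and>
    (\<forall>i\<le>l - 1. DA (toggles As X (2 * i)) \<and> card (toggles As X (2 * i)) = k) \<and>
    toggles As X (2 * (l - 1)) = At)"
    (is "_ \<longleftrightarrow> 1 \<le> l \<and> ?R")
proof -
  let ?W = "(near E (2 * p + 1) ^^ p) Z"
  have "tj_reconfigurable V E As At l \<longleftrightarrow> 1 \<le> l \<and> (\<exists>A. A 0 = As \<and> A (l - 1) = At \<and>
     (\<forall>i\<le>l - 1. DA (A i) \<and> card (A i) = k) \<and> (\<forall>i<l - 1. card (A (Suc i) - A i) \<le> 1))" (is "_ \<longleftrightarrow> ?M")
  proof
    assume "tj_reconfigurable V E As At l"
    then obtain A where l: "1 \<le> l" and A: "A 0 = As" "A (l - 1) = At" "\<And>i. i \<le> l - 1 \<Longrightarrow> DA (A i)"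
      "\<And>i. i < l - 1 \<Longrightarrow> A (Suc i) = A i \<or> tj_step (A i) (A (Suc i))"
      unfolding tj_reconfigurable_def successively_stutter by blast
    have k: "card (A i) = k" if "i \<le> l - 1" for i
      using that
    proof (induction i)
      case (Suc i)
      with A(4)[of i] show ?case by (auto simp: tj_step_def)
    qed (simp add: A(1) assms)
    have "card (A (Suc i) - A i) \<le> 1" if "i < l - 1" for i
      using tj_step_card[of "A i" "A (Suc i)"] A(3)[THEN DA_finite] A(4)[OF that] k that by auto
    with l A k show ?M by blast
  next
    assume ?M
    then obtain A where l: "1 \<le> l" and A: "A 0 = As" "A (l - 1) = At"
      "\<And>i. i \<le> l - 1 \<Longrightarrow> DA (A i) \<and> card (A i) = k"
      "\<And>i. i < l - 1 \<Longrightarrow> card (A (Suc i) - A i) \<le> 1" by blast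
    have "A (Suc i) = A i \<or> tj_step (A i) (A (Suc i))" if "i < l - 1" for i
      using tj_step_card[of "A i" "A (Suc i)"] A(3)[of i] A(3)[of "Suc i"] DA_finite A(4)[OF that] that by auto
    with l A show "tj_reconfigurable V E As At l"
      unfolding tj_reconfigurable_def successively_stutter by blast
  qed
  also have "\<dots> \<longleftrightarrow> 1 \<le> l \<and> ?R"
  proof (intro conj_cong refl iffI)
    assume "\<exists>A. A 0 = As \<and> A (l - 1) = At \<and>
      (\<forall>i\<le>l - 1. DA (A i) \<and> card (A i) = k) \<and> (\<forall>i<l - 1. card (A (Suc i) - A i) \<le> 1)"
    then obtain A where A: "A 0 = As" "A (l - 1) = At"
      "\<And>i. i \<le> l - 1 \<Longrightarrow> DA (A i) \<and> card (A i) = k"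
      "\<And>i. i < l - 1 \<Longrightarrow> card (A (Suc i) - A i) \<le> 1" by blast
    from confine_tj[where A = A and k = k and m = "l - 1" and p = p and Z = Z, OF _ A(3,4) _ _ T] A(1,2) assms(5,6)
    obtain B where B: "B 0 = As" "B (l - 1) = At" "\<And>i. i \<le> l - 1 \<Longrightarrow> DA (B i) \<and> card (B i) = k"
      "\<And>i. i \<le> l - 1 \<Longrightarrow> B i \<subseteq> ?W" "\<And>i. i < l - 1 \<Longrightarrow> card (B (Suc i) - B i) \<le> 1" by auto
    have "\<exists>X Y. small ?W X \<and> small ?W Y \<and> B (Suc i) = toggle (toggle (B i) X) Y" if "i < l - 1" for i
      by (rule toggle_twice) (use B(3)[of i] B(3)[of "Suc i"] B(4)[of i] B(4)[of "Suc i"] B(5)[of i] that DA_finite in auto)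
    then obtain X Y where XY: "\<And>i. i < l - 1 \<Longrightarrow> small ?W (X i) \<and> small ?W (Y i) \<and>
      B (Suc i) = toggle (toggle (B i) (X i)) (Y i)" by metis
    define X' where "X' = (\<lambda>j. if even j then X (j div 2) else Y (j div 2))"
    have "toggles As X' (2 * i) = B i" if "i \<le> l - 1" for i
      using that by (induction i) (auto simp: B(1) XY X'_def)
    moreover have "small ?W (X' j)" if "j < 2 * (l - 1)" for j
      using XY[of "j div 2"] that by (auto simp: X'_def)
    ultimately show ?R using B by (intro exI[of _ X']) auto
  next
    assume ?R
    then obtain X where X: "\<And>j. j < 2 * (l - 1) \<Longrightarrow> small ?W (X j)"
      "\<And>i. i \<le> l - 1 \<Longrightarrow> DA (toggles As X (2 * i)) \<and> card (toggles As X (2 * i)) = k"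
      "toggles As X (2 * (l - 1)) = At" by blast
    have "card (toggles As X (2 * Suc i) - toggles As X (2 * i)) \<le> 1" if i: "i < l - 1" for i
    proof (rule ccontr)
      let ?A = "toggles As X (2 * i)" and ?B = "toggles As X (2 * Suc i)"
      assume c: "\<not> card (?B - ?A) \<le> 1"
      have B: "?B = toggle (toggle ?A (X (2 * i))) (X (Suc (2 * i)))" by simp
      have s: "small ?W (X (2 * i))" "small ?W (X (Suc (2 * i)))" using X(1) i by auto
      have fin: "finite ?A" "finite ?B" using X(2)[of i] X(2)[of "Suc i"] i DA_finite by auto
      have "card (?A - ?B) = card (?B - ?A)"
        by (rule card_Diff_sym) (use X(2)[of i] X(2)[of "Suc i"] i fin in simp_all)
      have "(?B - ?A) \<union> (?A - ?B) \<subseteq> X (2 * i) \<union> X (Suc (2 * i))"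
        unfolding B by (auto simp: toggle_def)
      then have "card ((?B - ?A) \<union> (?A - ?B)) \<le> card (X (2 * i) \<union> X (Suc (2 * i)))"
        using s by (intro card_mono) (auto simp: small_def)
      also have "\<dots> \<le> 1 + 1"
        using s by (intro order_trans[OF card_Un_le] add_mono) (auto simp: small_def)
      also have "card ((?B - ?A) \<union> (?A - ?B)) = card (?B - ?A) + card (?A - ?B)"
        using fin by (intro card_Un_disjoint) auto
      finally show False using c \<open>card (?A - ?B) = card (?B - ?A)\<close> by linarith
    qed
    with X show "\<exists>A. A 0 = As \<and> A (l - 1) = At \<and>
      (\<forall>i\<le>l - 1. DA (A i) \<and> card (A i) = k) \<and> (\<forall>i<l - 1. card (A (Suc i) - A i) \<le> 1)"
      by (intro exI[of _ "\<lambda>i. toggles As X (2 * i)"]) simp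
  qed
  finally show ?thesis .
qed


lemma card_W:
  assumes "DA As" "DA At" "card As \<le> k" "card At \<le> k" "k \<le> p" "T \<subseteq> leaves" "card T \<le> 2 * p"
  shows "finite ((near E (2 * p + 1) ^^ p) (As \<union> At \<union> T))" (is "finite ?W")
    and "card ((near E (2 * p + 1) ^^ p) (As \<union> At \<union> T)) \<le> 4 * p * (2 * p + 2) ^ p"
proof -
  let ?Z = "As \<union> At \<union> T"
  have "finite leaves" using finite_V by (simp add: leaves_def)
  then have fin: "finite ?Z" using assms DA_finite finite_subset by auto
  have "card ?Z \<le> card As + card At + card T"
    by (meson add_le_mono1 card_Un_le le_trans)
  then have Z: "card ?Z \<le> 4 * p" using assms by linarith
  have deg: "card (E `` {v}) \<le> 2 * p + 1" if "v \<in> ?Z" for v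
    using that
  proof (elim UnE)
    assume "v \<in> As"
    then show ?thesis using DA_degree[OF assms(1) _ assms(3)] assms(5) by fastforce
  next
    assume "v \<in> At"
    then show ?thesis using DA_degree[OF assms(2) _ assms(4)] assms(5) by fastforce
  next
    assume "v \<in> T"
    then show ?thesis using assms(6) by (auto simp: leaves_def)
  qed
  note W = near_iterate[OF fin deg, of p, simplified Suc_eq_plus1[symmetric]]
  show "finite ?W" using W by simp
  have "card ?W \<le> card ?Z * (2 * p + 2) ^ p" using W by simp
  also have "\<dots> \<le> 4 * p * (2 * p + 2) ^ p" using Z by (rule mult_right_mono) simp
  finally show "card ?W \<le> 4 * p * (2 * p + 2) ^ p" .
qed

end

text \<open>Origin of \<open>4 * p + 5\<close>: by \<open>x + 1 \<le> 2 ^ x\<close>, the base is at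
  most \<open>2 ^ (4 * p + (2 * p + 1) * p)\<close>. Raised to the power \<open>2 * p\<close> this
  has exponent \<open>2 * p * p * (2 * p + 5)\<close>, whose factors are at most 2 to the powers
  \<open>1\<close>, \<open>p\<close>, \<open>p\<close> and \<open>2 * p + 4\<close>.\<close>

lemma search_space_bound:
  assumes "b \<le> 4 * p * (2 * p + 2) ^ p + 1" "0 < b" "m \<le> 2 * p"
  shows "b ^ m \<le> 2 ^ 2 ^ (4 * p + 5)"
proof -
  have lt: "x + 1 \<le> 2 ^ x" for x :: nat
    using less_exp[of x] by linarith
  have "4 * p * (2 * p + 2) ^ p + 1 \<le> (4 * p + 1) * (2 * p + 2) ^ p"
    by (simp add: algebra_simps)
  also have "\<dots> \<le> 2 ^ (4 * p) * (2 ^ (2 * p + 1)) ^ p"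
    using lt[of "4 * p"] lt[of "2 * p + 1"] by (intro mult_mono power_mono) auto
  also have "\<dots> = 2 ^ (4 * p + (2 * p + 1) * p)"
    by (simp only: power_add power_mult)
  finally have "b \<le> 2 ^ (4 * p + (2 * p + 1) * p)" using assms(1) by linarith
  then have "b ^ m \<le> (2 ^ (4 * p + (2 * p + 1) * p)) ^ m" by (rule power_mono) simp
  also have "\<dots> \<le> (2 ^ (4 * p + (2 * p + 1) * p)) ^ (2 * p)"
    using assms(3) by (rule power_increasing) simp
  also have "\<dots> = 2 ^ ((4 * p + (2 * p + 1) * p) * (2 * p))"
    by (simp only: power_mult)
  also have "(4 * p + (2 * p + 1) * p) * (2 * p) = 2 * p * p * (2 * p + 5)"
    by (simp add: algebra_simps)
  also have "2 * p * p * (2 * p + 5) \<le> 2 ^ 1 * 2 ^ p * 2 ^ p * 2 ^ (2 * p + 4)"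
    using lt[of p] lt[of "2 * p + 4"] by (intro mult_mono) auto
  also have "\<dots> = 2 ^ (4 * p + 5)"
    by (simp only: power_add[symmetric]) (simp add: algebra_simps)
  finally show ?thesis by simp
qed

text \<open>The range of \<open>c\<close> may be generous: every number decodes to moves inside
  \<open>W\<close>, so whatever is accepted is a genuine sequence. The size of the range matters
  only for completeness. Checks start at \<open>Suc i\<close> because the initial set is valid by
  hypothesis.\<close>

lemma reconfigurable_search:
  fixes n p :: nat and E :: "(nat \<times> nat) set" and tj :: bool
  assumes g: "simple_graph {..<n} E"
    and DA: "defensive_alliance {..<n} E As" "defensive_alliance {..<n} E At"
    and card: "card_ok tj k As" "card_ok tj k At"
    and p: "k + l = p"
  defines "W \<equiv> (near E (2 * p + 1) ^^ p) (As \<union> At \<union> firsts (2 * p) {v \<in> {..<n}. card (E `` {v}) \<le> 1})"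
  defines "X \<equiv> \<lambda>c j. pick W (c div (card W + 1) ^ j mod (card W + 1))"
  shows "reconfigurable tj {..<n} E As At k l \<longleftrightarrow> 1 \<le> l \<and> (\<exists>c < 2 ^ 2 ^ (4 * p + 5).
    (\<forall>i<l - 1. defensive_alliance {..<n} E (toggles As (X c) (width tj * Suc i)) \<and>
       card_ok tj k (toggles As (X c) (width tj * Suc i))) \<and>
    toggles As (X c) (width tj * (l - 1)) = At)"
proof -
  interpret graph "{..<n}" E by unfold_locales (rule g)
  let ?T = "firsts (2 * p) leaves" and ?b = "card W + 1"
  have W: "W = (near E (2 * p + 1) ^^ p) (As \<union> At \<union> ?T)"
    by (simp add: W_def leaves_def)
  have fl: "finite leaves" by (simp add: leaves_def)
  have T: "?T \<subseteq> leaves" "card ?T \<le> 2 * p" "?T = leaves \<or> 2 * p \<le> card ?T"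
    using card_firsts[OF fl, of "2 * p"] firsts_eq[OF fl, of "2 * p"] by (auto simp: firsts_def not_le)
  have card': "card As \<le> k" "card At \<le> k" using card by (auto simp: card_ok_def split: if_splits)
  have kp: "k \<le> p" using p by simp
  note cW = card_W[OF DA card' kp T(1,2), folded W]
  have "reconfigurable tj {..<n} E As At k l \<longleftrightarrow> 1 \<le> l \<and> (\<exists>Y.
    (\<forall>j<width tj * (l - 1). small W (Y j)) \<and>
    (\<forall>i\<le>l - 1. DA (toggles As Y (width tj * i)) \<and> card_ok tj k (toggles As Y (width tj * i))) \<and>
    toggles As Y (width tj * (l - 1)) = At)"
  proof (cases tj)
    case True
    have "As \<union> At \<union> ?T \<subseteq> {..<n}"
      using DA DA_sub T(1) by (auto simp: leaves_def)
    then show ?thesis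
      using True card reconfigurable_tj[OF DA _ _ p _ _ T(1) _ T(3), of "As \<union> At \<union> ?T"]
      unfolding W by (simp add: card_ok_def reconfigurable_def width_def)
  next
    case False
    then show ?thesis
      using reconfigurable_tar[OF DA card' p, of "As \<union> At \<union> ?T"]
      unfolding W by (simp add: card_ok_def reconfigurable_def width_def)
  qed
  also have "\<dots> \<longleftrightarrow> 1 \<le> l \<and> (\<exists>c < 2 ^ 2 ^ (4 * p + 5).
    (\<forall>i<l - 1. DA (toggles As (X c) (width tj * Suc i)) \<and> card_ok tj k (toggles As (X c) (width tj * Suc i))) \<and>
    toggles As (X c) (width tj * (l - 1)) = At)"
  proof (intro conj_cong refl iffI)
    let ?m = "width tj * (l - 1)"
    assume l: "1 \<le> l"
    assume "\<exists>Y. (\<forall>j<?m. small W (Y j)) \<and>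
      (\<forall>i\<le>l - 1. DA (toggles As Y (width tj * i)) \<and> card_ok tj k (toggles As Y (width tj * i))) \<and>
      toggles As Y ?m = At"
    then obtain Y where Y: "\<And>j. j < ?m \<Longrightarrow> small W (Y j)"
      "\<And>i. i \<le> l - 1 \<Longrightarrow> DA (toggles As Y (width tj * i)) \<and> card_ok tj k (toggles As Y (width tj * i))"
      "toggles As Y ?m = At" by blast
    have "\<forall>j. \<exists>d. j < ?m \<longrightarrow> d < ?b \<and> Y j = pick W d"
      using ex_pick[OF cW(1) Y(1)] by blast
    from choice[OF this] obtain d where d: "\<And>j. j < ?m \<Longrightarrow> d j < ?b \<and> Y j = pick W (d j)"
      by blast
    then obtain c where c: "c < ?b ^ ?m" "\<forall>j<?m. c div ?b ^ j mod ?b = d j"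
      using ex_digits[of ?b ?m d] by auto
    have "?m \<le> 2 * p" using p by (auto simp: width_def)
    with cW(2) have F: "?b ^ ?m \<le> 2 ^ 2 ^ (4 * p + 5)" by (intro search_space_bound) auto
    have eq: "toggles As (X c) j = toggles As Y j" if "j \<le> ?m" for j
      using that
    proof (induction j)
      case (Suc j)
      then have "X c j = Y j" unfolding X_def using c(2) d by simp
      with Suc show ?case by simp
    qed simp
    have eq': "toggles As (X c) (width tj * i) = toggles As Y (width tj * i)" if "i \<le> l - 1" for i
      using that by (intro eq mult_left_mono) auto
    show "\<exists>c < 2 ^ 2 ^ (4 * p + 5).
      (\<forall>i<l - 1. DA (toggles As (X c) (width tj * Suc i)) \<and> card_ok tj k (toggles As (X c) (width tj * Suc i))) \<and>
      toggles As (X c) ?m = At"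
    proof (rule exI[of _ c], intro conjI)
      show "c < 2 ^ 2 ^ (4 * p + 5)" using c(1) F by (rule less_le_trans)
      show "\<forall>i<l - 1. DA (toggles As (X c) (width tj * Suc i)) \<and> card_ok tj k (toggles As (X c) (width tj * Suc i))"
        using Y(2) eq' by (metis Suc_leI)
      show "toggles As (X c) ?m = At" using eq'[of "l - 1"] Y(3) by (metis order_refl)
    qed
  next
    assume "\<exists>c < 2 ^ 2 ^ (4 * p + 5).
      (\<forall>i<l - 1. DA (toggles As (X c) (width tj * Suc i)) \<and> card_ok tj k (toggles As (X c) (width tj * Suc i))) \<and>
      toggles As (X c) (width tj * (l - 1)) = At"
    then obtain c where c:
      "\<And>i. i < l - 1 \<Longrightarrow> DA (toggles As (X c) (width tj * Suc i)) \<and> card_ok tj k (toggles As (X c) (width tj * Suc i))"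
      "toggles As (X c) (width tj * (l - 1)) = At" by blast
    have "DA (toggles As (X c) (width tj * i)) \<and> card_ok tj k (toggles As (X c) (width tj * i))" if "i \<le> l - 1" for i
    proof (cases i)
      case 0
      then show ?thesis using DA(1) card(1) by simp
    next
      case (Suc i')
      then show ?thesis using c(1)[of i'] that by simp
    qed
    moreover have "small W (X c j)" for j
      unfolding X_def by (rule small_pick[OF cW(1)])
    ultimately show "\<exists>Y. (\<forall>j<width tj * (l - 1). small W (Y j)) \<and>
      (\<forall>i\<le>l - 1. DA (toggles As Y (width tj * i)) \<and> card_ok tj k (toggles As Y (width tj * i))) \<and>
      toggles As Y (width tj * (l - 1)) = At"
      using c(2) by (intro exI[of _ "X c"]) auto
  qed
  finally show ?thesis .
qed


section \<open>The program\<close>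

text \<open>\<open>vP\<close> has to be variable 0: its register is the one that holds the parameter
  at the start and the answer at the end. \<open>iz\<close> is the index of the products inside
  \<open>eAdj\<close>, \<open>eSrc\<close> and \<open>eTgt\<close>, whence the side conditions
  \<open>i \<noteq> iz\<close> below.\<close>

abbreviation (input) "vP \<equiv> 0 :: nat"
abbreviation (input) "vN \<equiv> 19 :: nat"
abbreviation (input) "vK \<equiv> 2 :: nat"
abbreviation (input) "vL \<equiv> 3 :: nat"
abbreviation (input) "vM \<equiv> 4 :: nat"
abbreviation (input) "vX \<equiv> 5 :: nat"
abbreviation (input) "vY \<equiv> 6 :: nat"
abbreviation (input) "vF \<equiv> 7 :: nat"
abbreviation (input) "vB \<equiv> 8 :: nat"
abbreviation (input) "vR \<equiv> 9 :: nat"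
abbreviation (input) "vC \<equiv> 10 :: nat"
abbreviation (input) "vT \<equiv> 11 :: nat"
abbreviation (input) "vOk \<equiv> 12 :: nat"
abbreviation (input) "vI \<equiv> 13 :: nat"
abbreviation (input) "vQ \<equiv> 14 :: nat"
abbreviation (input) "vV \<equiv> 15 :: nat"
abbreviation (input) "iu \<equiv> 16 :: nat"
abbreviation (input) "iv \<equiv> 17 :: nat"
abbreviation (input) "iz \<equiv> 18 :: nat"

text \<open>Truth is being nonzero. Truncated subtraction from 1 negates, and a double negation
  normalizes to 0 or 1.\<close>

definition "eNot e = Sub (Num 1) e"
definition "eOr a b = eNot (eNot (Add a b))"
definition "eAnd a b = eNot (Add (eNot a) (eNot b))"
definition "eLe a b = eNot (Sub a b)"
definition "eLt a b = eNot (eNot (Sub b a))"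
definition "eEq a b = eNot (Add (Sub a b) (Sub b a))"

lemma ev_bool [simp]:
  "ev x (eNot a) r M = of_bool (ev x a r M = 0)"
  "ev x (eOr a b) r M = of_bool (ev x a r M \<noteq> 0 \<or> ev x b r M \<noteq> 0)"
  "ev x (eAnd a b) r M = of_bool (ev x a r M \<noteq> 0 \<and> ev x b r M \<noteq> 0)"
  "ev x (eLe a b) r M = of_bool (ev x a r M \<le> ev x b r M)"
  "ev x (eLt a b) r M = of_bool (ev x a r M < ev x b r M)"
  "ev x (eEq a b) r M = of_bool (ev x a r M = ev x b r M)"
  by (auto simp: eNot_def eOr_def eAnd_def eLe_def eLt_def eEq_def of_bool_def)

text \<open>The row offset is a product, computed as a sum of \<open>n\<close> equal terms; 3 skips
  the header \<open>n\<close>, \<open>k\<close>, \<open>l\<close>.\<close>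

definition eAdj :: "nat \<Rightarrow> nat \<Rightarrow> ex" where
  "eAdj i j = Inp (Add (Num 3) (Add (Sum iz vN (Var i)) (Var j)))"

definition eSrc :: "nat \<Rightarrow> ex" where
  "eSrc i = Inp (Add (Num 3) (Add (Sum iz vN (Var vN)) (Var i)))"

definition eTgt :: "nat \<Rightarrow> ex" where
  "eTgt i = Inp (Add (Num 3) (Add (Sum iz vN (Var vN)) (Add (Var vN) (Var i))))"

definition eArr :: "bool \<Rightarrow> nat \<Rightarrow> ex" where
  "eArr j i = Arr j (Var i)"

text \<open>A universal statement becomes the negation of a count of violators. \<open>S\<close>
  yields the membership test for an index variable, so one expression serves the two input vectors
  and the current array.\<close>

definition eDA :: "(nat \<Rightarrow> ex) \<Rightarrow> ex" where
  "eDA S = eNot (Sum iv vN (eAnd (S iv)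
     (eLt (Add (Sum iu vN (eAnd (eAdj iv iu) (S iu))) (Num 1))
          (Sum iu vN (eAnd (eAdj iv iu) (eNot (S iu)))))))"

definition eCard :: "bool \<Rightarrow> (nat \<Rightarrow> ex) \<Rightarrow> ex" where
  "eCard tj S = (if tj then eEq (Sum iv vN (S iv)) (Var vK) else eLe (Sum iv vN (S iv)) (Var vK))"

text \<open>The comparison with entry 0 detects that \<open>vN\<close> was truncated to the length
  of the word.\<close>

definition eShape :: ex where
  "eShape = eAnd (eEq (Inp (Num 0)) (Var vN))
    (eAnd (eEq Len (Add (Num 3) (Add (Sum iz vN (Var vN)) (Add (Var vN) (Var vN)))))
    (eAnd (eEq (Add (Var vK) (Var vL)) (Var vP))
    (eAnd (eNot (Sum iv vN (Sum iu vN (eLt (Num 1) (eAdj iv iu)))))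
    (eAnd (eNot (Sum iv vN (eLt (Num 1) (eSrc iv)))) (eNot (Sum iv vN (eLt (Num 1) (eTgt iv))))))))"

definition eGraph :: ex where
  "eGraph = eAnd (eNot (Sum iv vN (Sum iu vN (eNot (eEq (eAdj iv iu) (eAdj iu iv))))))
     (eNot (Sum iv vN (eAdj iv iv)))"

definition eValid :: "bool \<Rightarrow> ex" where
  "eValid tj = eAnd eShape (eAnd eGraph (eAnd (eAnd (eDA eSrc) (eDA eTgt))
     (eAnd (eAnd (eCard tj eSrc) (eCard tj eTgt)) (Var vL))))"

definition eLow :: "nat \<Rightarrow> nat \<Rightarrow> ex \<Rightarrow> ex" where
  "eLow i j e = eLe (Sum j vN (eAdj i j)) e"

text \<open>Counting the smaller leaves gives the rank of a leaf, so the comparison with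
  \<open>2 * p\<close> selects the set \<open>firsts\<close>.\<close>

definition pSeeds :: prog where
  "pSeeds = Fill False iv vN (eOr (eOr (eSrc iv) (eTgt iv))
     (eAnd (eLow iv iz (Num 1))
       (eLt (Sum iu vN (eAnd (eLow iu iz (Num 1)) (eLt (Var iu) (Var iv)))) (Add (Var vP) (Var vP)))))"

definition pGrow :: prog where
  "pGrow = For vI vP (Fill False iv vN (eOr (eArr False iv)
     (eAnd (eLow iv iu (Add (Var vP) (Add (Var vP) (Num 1))))
       (Sum iu vN (eAnd (eArr False iu) (eAdj iu iv))))))"

text \<open>Division by repeated subtraction without early exit: \<open>vF\<close> rounds suffice
  for a dividend of at most \<open>F\<close>, and surplus rounds change nothing. \<open>vQ\<close>
  is updated first because both tests must see the old \<open>vT\<close>.\<close>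

definition pDivMod :: prog where
  "pDivMod = PSeq (Put vQ (Num 0))
     (For iz vF (PSeq (Put vQ (Add (Var vQ) (eLe (Var vB) (Var vT))))
       (Put vT (Ite (eLe (Var vB) (Var vT)) (Sub (Var vT) (Var vB)) (Var vT)))))"

text \<open>\<open>vT\<close> carries the digits not yet consumed: the lowest one selects the move
  and the quotient is put back. Inequality of two truth values is membership in the symmetric
  difference.\<close>

definition pToggle :: prog where
  "pToggle = PSeq pDivMod (PSeq
     (Fill True iv vN (eNot (eEq (eArr True iv) (eAnd (eArr False iv)
       (eEq (Sum iu vN (eAnd (eArr False iu) (eLt (Var iu) (Var iv)))) (Var vT))))))
     (Put vT (Var vQ)))"

definition pStep :: "bool \<Rightarrow> prog" where
  "pStep tj = PSeq (if tj then PSeq pToggle pToggle else pToggle)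
     (Put vOk (eAnd (Var vOk) (eAnd (eDA (eArr True)) (eCard tj (eArr True)))))"

definition pTry :: "bool \<Rightarrow> prog" where
  "pTry tj = PSeq (Put vT (Var vC)) (PSeq (Put vOk (Num 1)) (PSeq (Fill True iv vN (eSrc iv))
     (PSeq (For vI vM (pStep tj))
       (Put vR (eOr (Var vR) (eAnd (Var vOk)
         (eNot (Sum iv vN (eNot (eEq (eArr True iv) (eTgt iv)))))))))))"

definition pMain :: "bool \<Rightarrow> prog" where
  "pMain tj = PSeq (Put vV (eValid tj)) (PSeq pSeeds (PSeq pGrow
     (PSeq (Put vB (Add (Sum iv vN (eArr False iv)) (Num 1)))
       (PSeq (Put vR (Num 0)) (For vC vF (pTry tj))))))"

text \<open>
  The bounds on \<open>n\<close> and \<open>l\<close> hold for all instances; they keep the running time under control on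
  inputs that encode none.
\<close>

definition pInit :: "nat \<Rightarrow> prog" where
  "pInit a = PSeq (Put vN (Sub (Inp (Num 0)) (Sub (Inp (Num 0)) Len)))
     (PSeq (Put vK (Inp (Num 1)))
     (PSeq (Put vL (Inp (Num 2)))
     (PSeq (Put vM (Sub (Sub (Var vL) (Sub (Var vL) (Var vP))) (Num 1)))
     (PSeq (Put vX (Add (Add (Add (Var vP) (Var vP)) (Add (Var vP) (Var vP))) (Num a)))
     (PSeq (Put vY (Num 1)) (Put vF (Num 1)))))))"

definition pExp1 :: prog where
  "pExp1 = For iz vX (Put vY (Add (Var vY) (Var vY)))"

definition pExp2 :: prog where
  "pExp2 = For iz vY (Put vF (Add (Var vF) (Var vF)))"

definition pOut :: prog where
  "pOut = Put vP (eAnd (Var vV) (Var vR))"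

lemma sem_For_invariant:
  assumes "I 0 s" "\<And>k s'. k < fst s b \<Longrightarrow> I k s' \<Longrightarrow> I (Suc k) (sem x P ((fst s')(i := k), snd s'))"
  shows "I (fst s b) (sem x (For i b P) s)"
proof -
  have "I j (fold (\<lambda>k s. sem x P ((fst s)(i := k), snd s)) [0..<j] s)" if "j \<le> fst s b" for j
    using that by (induction j) (auto simp: assms)
  then show ?thesis by simp
qed


subsection \<open>The encoding\<close>

lemma length_encode: "length (encode n E As At k l) = 3 + n * n + n + n"
  by (simp add: encode_def)

lemma encode_nonempty: "encode n E As At k l \<noteq> []"
  by (simp add: encode_def)

lemma encode_0: "encode n E As At k l ! 0 = n"
  and encode_1: "encode n E As At k l ! 1 = k"
  and encode_2: "encode n E As At k l ! 2 = l"
  by (simp_all add: encode_def)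

lemma index_less: "u < n \<Longrightarrow> v < n \<Longrightarrow> n * u + v < n * (n :: nat)"
  by (metis add_less_cancel_left less_le_trans mult_Suc_right add.commute Suc_leI mult_le_mono2)

lemma encode_adj:
  assumes "u < n" "v < n"
  shows "encode n E As At k l ! (3 + (n * u + v)) = of_bool ((u, v) \<in> E)"
  using index_less[OF assms] assms
  by (simp add: encode_def nth_append List.product_nth numeral_3_eq_3)

lemma encode_src: "v < n \<Longrightarrow> encode n E As At k l ! (3 + (n * n + v)) = of_bool (v \<in> As)"
  by (simp add: encode_def nth_append numeral_3_eq_3)

lemma encode_tgt: "v < n \<Longrightarrow> encode n E As At k l ! (3 + (n * n + (n + v))) = of_bool (v \<in> At)"
  by (simp add: encode_def nth_append numeral_3_eq_3)

text \<open>Needed for arbitrary words: entries of at most 1 are determined by where they equal 1,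
  so reading off the three sets and encoding them again restores the word.\<close>

lemma encode_exhaust:
  assumes len: "length x = 3 + n * n + n + n" and n: "x ! 0 = n"
    and adj: "\<And>u v. u < n \<Longrightarrow> v < n \<Longrightarrow> x ! (3 + (n * u + v)) \<le> 1"
    and src: "\<And>v. v < n \<Longrightarrow> x ! (3 + (n * n + v)) \<le> 1"
    and tgt: "\<And>v. v < n \<Longrightarrow> x ! (3 + (n * n + (n + v))) \<le> 1"
  shows "\<exists>E As At. E \<subseteq> {..<n} \<times> {..<n} \<and> As \<subseteq> {..<n} \<and> At \<subseteq> {..<n} \<and> x = encode n E As At (x ! 1) (x ! 2)"
proof -
  define E where "E = {(u, v). u < n \<and> v < n \<and> x ! (3 + (n * u + v)) = 1}"
  define As where "As = {v. v < n \<and> x ! (3 + (n * n + v)) = 1}"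
  define At where "At = {v. v < n \<and> x ! (3 + (n * n + (n + v))) = 1}"
  have "x = encode n E As At (x ! 1) (x ! 2)"
  proof (rule nth_equalityI)
    fix i assume i: "i < length x"
    consider "i = 0" | "i = 1" | "i = 2" | j where "i = 3 + j" "j < n * n"
      | j where "i = 3 + (n * n + j)" "j < n" | j where "i = 3 + (n * n + (n + j))" "j < n"
    proof -
      have "i < 3 \<or> i - 3 < n * n \<and> i = 3 + (i - 3) \<or>
          i - (3 + n * n) < n \<and> i = 3 + (n * n + (i - (3 + n * n))) \<or>
          i - (3 + n * n + n) < n \<and> i = 3 + (n * n + (n + (i - (3 + n * n + n))))"
        using i len by linarith
      moreover have "i < 3 \<Longrightarrow> i = 0 \<or> i = 1 \<or> i = 2" by linarith
      ultimately show ?thesis using that by metis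
    qed
    then show "x ! i = encode n E As At (x ! 1) (x ! 2) ! i"
    proof cases
      case (4 j)
      define u v where "u = j div n" and "v = j mod n"
      have "0 < n" using 4 by (cases n) auto
      then have uv: "j = n * u + v" "u < n" "v < n"
        using 4 by (simp_all add: u_def v_def less_mult_imp_div_less)
      then show ?thesis
        using adj[of u v] unfolding 4(1) uv(1) encode_adj[OF uv(2,3)] by (auto simp: E_def)
    next
      case (5 j)
      then show ?thesis using src[of j] by (auto simp: encode_src As_def)
    next
      case (6 j)
      then show ?thesis using tgt[of j] by (auto simp: encode_tgt At_def)
    qed (simp_all add: n encode_0 encode_1[simplified] encode_2)
  qed (simp add: len length_encode)
  then show ?thesis
    by (intro exI[of _ E] exI[of _ As] exI[of _ At]) (auto simp: E_def As_def At_def)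
qed

declare sum_of_bool_eq [simp del]

text \<open>Evaluated programs yield sums of \<open>of_bool\<close>. These stay the normal form, and
  the passage to cardinalities is made by hand.\<close>

lemma card_sum_of_bool: "A \<subseteq> {..<n} \<Longrightarrow> (\<Sum>v<n. of_bool (v \<in> A)) = card (A :: nat set)"
  by (subst sum_of_bool_eq) (auto intro!: arg_cong[where f = card])

text \<open>The relation need not be a graph and the sets need not be alliances: this is the setting
  in which the validity test itself is evaluated.\<close>

locale word =
  fixes n :: nat and E :: "(nat \<times> nat) set" and As At :: "nat set" and k l p :: nat
  assumes E_sub: "E \<subseteq> {..<n} \<times> {..<n}" and As_sub: "As \<subseteq> {..<n}" and At_sub: "At \<subseteq> {..<n}"
    and p_eq: "k + l = p"
begin

definition "x = encode n E As At k l"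

lemma ev_adj: "r vN = n \<Longrightarrow> r i < n \<Longrightarrow> r j < n \<Longrightarrow> i \<noteq> iz \<Longrightarrow> ev x (eAdj i j) r M = of_bool ((r i, r j) \<in> E)"
  using index_less[of "r i" n "r j"] encode_adj[of "r i" n "r j" E As At k l]
  by (simp add: eAdj_def x_def length_encode)

lemma ev_src: "r vN = n \<Longrightarrow> r i < n \<Longrightarrow> i \<noteq> iz \<Longrightarrow> ev x (eSrc i) r M = of_bool (r i \<in> As)"
  using encode_src[of "r i" n E As At k l] by (simp add: eSrc_def x_def length_encode)

lemma ev_tgt: "r vN = n \<Longrightarrow> r i < n \<Longrightarrow> i \<noteq> iz \<Longrightarrow> ev x (eTgt i) r M = of_bool (r i \<in> At)"
  using encode_tgt[of "r i" n E As At k l] by (simp add: eTgt_def x_def length_encode)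

lemma deg_sum: "deg_in E A v = (\<Sum>u<n. of_bool ((v, u) \<in> E \<and> u \<in> A))"
proof -
  have "(\<Sum>u<n. of_bool (u \<in> E `` {v} \<inter> A)) = card (E `` {v} \<inter> A)"
    by (rule card_sum_of_bool) (use E_sub in auto)
  then show ?thesis by (simp add: deg_in_def)
qed

lemma degree_sum: "card (E `` {v}) = (\<Sum>u<n. of_bool ((v, u) \<in> E))"
  using deg_sum[of UNIV v] by (simp add: deg_in_def)

lemma ev_DA:
  assumes n: "r vN = n" and A: "A \<subseteq> {..<n}"
    and S: "\<And>r i. r vN = n \<Longrightarrow> r i < n \<Longrightarrow> i \<in> {iu, iv} \<Longrightarrow> ev x (S i) r M = of_bool (r i \<in> A)"
  shows "ev x (eDA S) r M = of_bool (defensive_alliance {..<n} E A)"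
proof -
  have out: "deg_in E ({..<n} - A) v = (\<Sum>u<n. of_bool ((v, u) \<in> E \<and> u \<notin> A))" for v
    unfolding deg_sum by (rule sum.cong) auto
  have "ev x (eDA S) r M = of_bool (\<forall>v<n. v \<in> A \<longrightarrow> \<not> deg_in E A v + 1 < deg_in E ({..<n} - A) v)"
    unfolding out deg_sum[of A] by (auto simp: eDA_def n S ev_adj)
  then show ?thesis
    using A by (auto simp: defensive_alliance_def not_less)
qed

lemma ev_card:
  assumes "r vN = n" "r vK = k" "A \<subseteq> {..<n}"
    and "\<And>r. r vN = n \<Longrightarrow> r iv < n \<Longrightarrow> ev x (S iv) r M = of_bool (r iv \<in> A)"
  shows "ev x (eCard tj S) r M = of_bool (card_ok tj k A)"
  using card_sum_of_bool[OF assms(3)] by (simp add: eCard_def card_ok_def assms(1,2,4))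

lemma ev_valid:
  assumes "r vP = p" "r vN = n" "r vK = k" "r vL = l"
  shows "ev x (eValid tj) r M \<noteq> 0 \<longleftrightarrow> simple_graph {..<n} E \<and>
    defensive_alliance {..<n} E As \<and> defensive_alliance {..<n} E At \<and> card_ok tj k As \<and> card_ok tj k At \<and> 1 \<le> l"
proof -
  have "ev x eShape r M \<noteq> 0"
    using assms p_eq
    by (simp add: eShape_def ev_adj ev_src ev_tgt)
      (simp add: x_def length_encode encode_0 encode_nonempty of_bool_def)
  moreover have "ev x eGraph r M \<noteq> 0 \<longleftrightarrow> simple_graph {..<n} E"
  proof -
    have "ev x eGraph r M \<noteq> 0 \<longleftrightarrow> (\<forall>v<n. \<forall>u<n. ((v, u) \<in> E) = ((u, v) \<in> E)) \<and> (\<forall>v<n. (v, v) \<notin> E)"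
      using assms by (auto simp: eGraph_def ev_adj)
    also have "\<dots> \<longleftrightarrow> simple_graph {..<n} E"
      using E_sub unfolding simple_graph_def sym_def irrefl_def by blast
    finally show ?thesis .
  qed
  moreover have "ev x (eDA eSrc) r M = of_bool (defensive_alliance {..<n} E As)"
    by (rule ev_DA[where S = eSrc and r = r and A = As, OF assms(2) As_sub]) (rule ev_src; force)
  moreover have "ev x (eDA eTgt) r M = of_bool (defensive_alliance {..<n} E At)"
    by (rule ev_DA[where S = eTgt and r = r and A = At, OF assms(2) At_sub]) (rule ev_tgt; force)
  moreover have "ev x (eCard tj eSrc) r M = of_bool (card_ok tj k As)"
    by (rule ev_card[where S = eSrc and r = r and A = As, OF assms(2,3) As_sub]) (rule ev_src; force)
  moreover have "ev x (eCard tj eTgt) r M = of_bool (card_ok tj k At)"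
    by (rule ev_card[where S = eTgt and r = r and A = At, OF assms(2,3) At_sub]) (rule ev_tgt; force)
  ultimately show ?thesis
    using assms by (auto simp: eValid_def)
qed

end

lemma shape_word:
  assumes r: "r vN = min (ev x (Inp (Num 0)) r M) (length x)" "r vK = ev x (Inp (Num 1)) r M"
    "r vL = ev x (Inp (Num 2)) r M" and "ev x eShape r M \<noteq> 0"
  shows "\<exists>E As At. word (r vN) E As At (r vK) (r vL) (r vP) \<and> x = encode (r vN) E As At (r vK) (r vL)"
proof -
  let ?n = "r vN"
  have len: "length x = 3 + ?n * ?n + ?n + ?n" and kl: "r vK + r vL = r vP" and n: "x ! 0 = ?n"
    using assms(4) by (auto simp: eShape_def split: if_splits)
  have sh: "\<forall>v<?n. \<forall>u<?n. ev x (eAdj iv iu) (r(iv := v, iu := u)) M \<le> 1"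
    "\<forall>v<?n. ev x (eSrc iv) (r(iv := v)) M \<le> 1" "\<forall>v<?n. ev x (eTgt iv) (r(iv := v)) M \<le> 1"
    using assms(4) by (simp_all add: eShape_def not_less)
  have "x ! (3 + (?n * u + v)) \<le> 1" if "u < ?n" "v < ?n" for u v
  proof -
    have "ev x (eAdj iv iu) (r(iv := u, iu := v)) M = x ! (3 + (?n * u + v))"
      using index_less[OF that] len by (simp add: eAdj_def)
    with sh(1) that show ?thesis by metis
  qed
  moreover have "x ! (3 + (?n * ?n + v)) \<le> 1" if "v < ?n" for v
  proof -
    have "ev x (eSrc iv) (r(iv := v)) M = x ! (3 + (?n * ?n + v))"
      using that len by (simp add: eSrc_def)
    with sh(2) that show ?thesis by metis
  qed
  moreover have "x ! (3 + (?n * ?n + (?n + v))) \<le> 1" if "v < ?n" for v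
  proof -
    have "ev x (eTgt iv) (r(iv := v)) M = x ! (3 + (?n * ?n + (?n + v)))"
      using that len by (simp add: eTgt_def)
    with sh(3) that show ?thesis by metis
  qed
  ultimately have "\<exists>E As At. E \<subseteq> {..<?n} \<times> {..<?n} \<and> As \<subseteq> {..<?n} \<and> At \<subseteq> {..<?n} \<and>
      x = encode ?n E As At (x ! 1) (x ! 2)"
    using encode_exhaust[OF len n] by blast
  moreover have "r vK = x ! 1" "r vL = x ! 2"
    using r(2,3) len by simp_all
  ultimately show ?thesis using kl unfolding word_def by metis
qed



subsection \<open>Correctness\<close>

locale yes_shape = word +
  fixes tj :: bool
  assumes simple: "simple_graph {..<n} E"
    and DA_As: "defensive_alliance {..<n} E As" and DA_At: "defensive_alliance {..<n} E At"
    and ok_As: "card_ok tj k As" and ok_At: "card_ok tj k At" and l_pos: "1 \<le> l"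
begin

definition "Z = As \<union> At \<union> firsts (2 * p) {v \<in> {..<n}. card (E `` {v}) \<le> 1}"
definition "W = (near E (2 * p + 1) ^^ p) Z"
definition "b = card W + 1"
definition "F = (2 :: nat) ^ 2 ^ (4 * p + 5)"
definition "tog c = toggles As (\<lambda>j. pick W (c div b ^ j mod b))"

definition "env_ok r \<longleftrightarrow> r vP = p \<and> r vN = n \<and> r vK = k \<and> r vL = l \<and> r vM = l - 1 \<and> r vF = F"

lemma env_ok_upd [simp]: "i \<notin> {vP, vN, vK, vL, vM, vF} \<Longrightarrow> env_ok (r(i := a)) = env_ok r"
  by (auto simp: env_ok_def)

definition repr :: "arrays \<Rightarrow> bool \<Rightarrow> nat set \<Rightarrow> bool" where
  "repr M j S \<longleftrightarrow> S \<subseteq> {..<n} \<and> (\<forall>v<n. M j v = of_bool (v \<in> S))"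

lemma near_sub: "S \<subseteq> {..<n} \<Longrightarrow> (near E D ^^ j) S \<subseteq> {..<n}"
  using graph.near_funpow_sub[of "{..<n}" E S j D] simple by (simp add: graph_def)

lemma Z_sub: "Z \<subseteq> {..<n}"
  using As_sub At_sub by (auto simp: Z_def firsts_def)

lemma W_sub: "W \<subseteq> {..<n}"
  unfolding W_def by (rule near_sub[OF Z_sub])

lemma tog_sub: "tog c j \<subseteq> {..<n}"
  unfolding tog_def using As_sub W_sub by (induction j) (auto simp: toggle_def pick_def)

lemma b_pos: "0 < b"
  by (simp add: b_def)

lemma ev_low: "r vN = n \<Longrightarrow> r i < n \<Longrightarrow> i \<noteq> iz \<Longrightarrow> i \<noteq> j \<Longrightarrow> j \<noteq> vN \<Longrightarrow>
    ev x (eLow i j e) r M = of_bool (card (E `` {r i}) \<le> ev x e r M)"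
  by (simp add: eLow_def ev_adj degree_sum)

lemma ev_arr: "repr M j S \<Longrightarrow> r i < n \<Longrightarrow> ev x (eArr j i) r M = of_bool (r i \<in> S)"
  by (simp add: eArr_def repr_def)

lemma rank_sum: "S \<subseteq> {..<n} \<Longrightarrow> (\<Sum>u<n. of_bool (u \<in> S \<and> u < v)) = rank S v"
  using card_sum_of_bool[of "{u \<in> S. u < v}" n] by (auto simp: rank_def)

lemma sem_seeds:
  assumes "env_ok r"
  shows "fst (sem x pSeeds (r, M)) = r" "repr (snd (sem x pSeeds (r, M))) False Z"
proof -
  let ?L = "{v \<in> {..<n}. card (E `` {v}) \<le> 1}"
  have r: "r vN = n" "r vP = p" using assms by (simp_all add: env_ok_def)
  have rank: "(\<Sum>u<n. of_bool (card (E `` {u}) \<le> 1 \<and> u < v)) = rank ?L v" for v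
    by (subst rank_sum[symmetric]) (auto intro: sum.cong)
  show "fst (sem x pSeeds (r, M)) = r"
    by (simp add: pSeeds_def)
  show "repr (snd (sem x pSeeds (r, M))) False Z"
    using Z_sub rank
    by (auto simp: repr_def pSeeds_def Z_def firsts_def r ev_src ev_tgt ev_low)
qed

lemma sem_grow:
  assumes "env_ok r" "repr M False Z"
  shows "env_ok (fst (sem x pGrow (r, M))) \<and> repr (snd (sem x pGrow (r, M))) False W"
proof -
  define I where "I = (\<lambda>j s. env_ok (fst s) \<and> repr (snd s) False ((near E (2 * p + 1) ^^ j) Z))"
  have "I (fst (r, M) vP) (sem x pGrow (r, M))"
    unfolding pGrow_def
  proof (rule sem_For_invariant)
    show "I 0 (r, M)" using assms by (simp add: I_def)
    fix j and s :: "env \<times> arrays"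
    assume I: "I j s"
    let ?S = "(near E (2 * p + 1) ^^ j) Z"
    have c: "fst s vN = n" "fst s vP = p" "env_ok (fst s)" and S: "repr (snd s) False ?S"
      using I by (simp_all add: I_def env_ok_def)
    have S_sub: "?S \<subseteq> {..<n}" by (rule near_sub[OF Z_sub])
    have S': "near E (2 * p + 1) ?S \<subseteq> {..<n}"
      using near_sub[OF Z_sub, of "Suc j" "2 * p + 1"] by simp
    have mem: "v \<in> near E (2 * p + 1) ?S \<longleftrightarrow>
        v \<in> ?S \<or> card (E `` {v}) \<le> p + (p + 1) \<and> (\<exists>u\<in>{..<n}. u \<in> ?S \<and> (u, v) \<in> E)" for v
      using S_sub by (auto simp: near_def mult_2)
    show "I (Suc j) (sem x (Fill False iv vN (eOr (eArr False iv)
     (eAnd (eLow iv iu (Add (Var vP) (Add (Var vP) (Num 1))))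
       (Sum iu vN (eAnd (eArr False iu) (eAdj iu iv)))))) ((fst s)(vI := j), snd s))"
      using c S' by (simp add: I_def repr_def[of "_(_ := _)"] ev_arr[OF S] ev_low ev_adj mem[unfolded Suc_eq_plus1[symmetric]])
  qed
  then show ?thesis using assms(1) by (simp add: I_def W_def env_ok_def)
qed

lemma sem_divmod:
  assumes c: "env_ok r" "r vB = b" "r vT \<le> F"
  shows "fst (sem x pDivMod (r, M)) vT = r vT mod b" "fst (sem x pDivMod (r, M)) vQ = r vT div b"
    "snd (sem x pDivMod (r, M)) = M"
proof -
  \<comment> \<open>After \<open>j\<close> rounds either the division is finished or every round has
    subtracted, so that the quotient is \<open>j\<close>. After \<open>F\<close> rounds the second
    case with a remainder of at least \<open>b\<close> would exceed the dividend.\<close>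
  define I where "I = (\<lambda>j s. snd s = M \<and> fst s vB = b \<and> r vT = fst s vQ * b + fst s vT \<and>
    (fst s vT < b \<or> fst s vQ = j))"
  have "I (fst (sem x (Put vQ (Num 0)) (r, M)) vF) (sem x pDivMod (r, M))"
    unfolding pDivMod_def sem.simps(3)
  proof (rule sem_For_invariant)
    show "I 0 (sem x (Put vQ (Num 0)) (r, M))" using c by (simp add: I_def)
  qed (auto simp: I_def)
  moreover have "fst (sem x (Put vQ (Num 0)) (r, M)) vF = F"
    using c by (simp add: env_ok_def)
  ultimately have I: "I F (sem x pDivMod (r, M))" by simp
  let ?t = "fst (sem x pDivMod (r, M)) vT" and ?q = "fst (sem x pDivMod (r, M)) vQ"
  have eq: "r vT = ?q * b + ?t" using I by (simp add: I_def)
  have "?t < b"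
  proof (rule ccontr)
    assume "\<not> ?t < b"
    with I have "?q = F" by (simp add: I_def)
    with eq c(3) have "F * b + ?t \<le> F" by simp
    moreover have "F \<le> F * b" using b_pos by simp
    ultimately show False using \<open>\<not> ?t < b\<close> b_pos by linarith
  qed
  with eq show "?t = r vT mod b" "?q = r vT div b" by simp_all
  show "snd (sem x pDivMod (r, M)) = M" using I by (simp add: I_def)
qed

lemma frame_toggle: "i \<notin> {vT, vQ, iu, iv, iz} \<Longrightarrow> fst (sem x pToggle s) i = fst s i"
  by (rule sem_frame) (auto simp: pToggle_def pDivMod_def eArr_def eNot_def eEq_def eAnd_def eLe_def eLt_def)

lemma frame_divmod: "i \<notin> {vT, vQ, iz} \<Longrightarrow> fst (sem x pDivMod s) i = fst s i"
  by (rule sem_frame) (auto simp: pDivMod_def eNot_def eLe_def)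

definition "tinv c j s \<longleftrightarrow> env_ok (fst s) \<and> fst s vB = b \<and> fst s vT = c div b ^ j \<and>
  repr (snd s) False W \<and> repr (snd s) True (tog c j)"

lemma sem_toggle:
  assumes c: "c < F" and s: "tinv c j s"
  shows "tinv c (Suc j) (sem x pToggle s)"
proof -
  obtain r M where s_eq: "s = (r, M)" by (cases s)
  have r: "env_ok r" "r vB = b" "r vT = c div b ^ j" and M: "repr M False W" "repr M True (tog c j)"
    using s by (simp_all add: tinv_def s_eq)
  have "c div b ^ j \<le> c" by (rule div_le_dividend)
  then have t: "r vT \<le> F" using c r(3) by linarith
  note dm = sem_divmod[OF r(1,2) t, of M]
  obtain r1 where r1: "sem x pDivMod (r, M) = (r1, M)"
    using dm(3) by (metis prod.collapse)
  have r1': "r1 vT = c div b ^ j mod b" "r1 vQ = c div b ^ Suc j" "r1 vN = n" "env_ok r1" "r1 vB = b"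
  proof -
    show "r1 vT = c div b ^ j mod b" using dm(1) r1 r(3) by simp
    show "r1 vQ = c div b ^ Suc j" using dm(2) r1 r(3) by (simp add: div_mult2_eq power_Suc2 del: power_Suc)
    have fr: "r1 i = r i" if "i \<notin> {vT, vQ, iz}" for i
      using frame_divmod[OF that, of "(r, M)"] r1 by simp
    show "env_ok r1" using r(1) by (simp add: env_ok_def fr)
    then show "r1 vN = n" by (simp add: env_ok_def)
    show "r1 vB = b" using r(2) fr by simp
  qed
  let ?X = "pick W (c div b ^ j mod b)"
  have tog: "tog c (Suc j) = toggle (tog c j) ?X" by (simp add: tog_def)
  have rank: "(\<Sum>u<n. of_bool (u \<in> W \<and> u < v)) = rank W v" for v
    by (rule rank_sum[OF W_sub])
  have "sem x pToggle s = (r1(vT := r1 vQ), M(True := \<lambda>v. if v < n then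
      ev x (eNot (eEq (eArr True iv) (eAnd (eArr False iv)
       (eEq (Sum iu vN (eAnd (eArr False iu) (eLt (Var iu) (Var iv)))) (Var vT))))) (r1(iv := v)) M else M True v))"
    unfolding pToggle_def sem.simps s_eq r1 by (simp only: fst_conv snd_conv ev.simps r1')
  moreover have "repr (M(True := \<lambda>v. if v < n then
      ev x (eNot (eEq (eArr True iv) (eAnd (eArr False iv)
       (eEq (Sum iu vN (eAnd (eArr False iu) (eLt (Var iu) (Var iv)))) (Var vT))))) (r1(iv := v)) M else M True v))
     True (tog c (Suc j))"
    using tog_sub[of c "Suc j"]
    by (auto simp: repr_def[of "_(_ := _)"] r1' ev_arr[OF M(1)] ev_arr[OF M(2)] rank tog toggle_def pick_def)
  moreover have "repr (M(True := f)) False W" for f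
    using M(1) by (simp add: repr_def)
  ultimately show ?thesis
    using r1' by (simp add: tinv_def)
qed

definition "good c i \<longleftrightarrow> defensive_alliance {..<n} E (tog c (width tj * Suc i)) \<and> card_ok tj k (tog c (width tj * Suc i))"

definition "sol c \<longleftrightarrow> (\<forall>i<l - 1. good c i) \<and> tog c (width tj * (l - 1)) = At"

lemma sem_step:
  assumes c: "c < F" and s: "tinv c (width tj * i) s" "fst s vOk = of_bool (\<forall>i'<i. good c i')"
  shows "tinv c (width tj * Suc i) (sem x (pStep tj) s) \<and>
    fst (sem x (pStep tj) s) vOk = of_bool (\<forall>i'<Suc i. good c i')"
proof -
  define s1 where "s1 = sem x (if tj then PSeq pToggle pToggle else pToggle) s"
  have s1: "tinv c (width tj * Suc i) s1"
    using sem_toggle[OF c s(1)] sem_toggle[OF c sem_toggle[OF c s(1)]]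
    by (cases tj) (simp_all add: s1_def width_def)
  have ok: "fst s1 vOk = fst s vOk"
    by (simp add: s1_def frame_toggle)
  have r: "fst s1 vN = n" "fst s1 vK = k" and M: "repr (snd s1) True (tog c (width tj * Suc i))"
    using s1 by (simp_all add: tinv_def env_ok_def)
  have DA: "ev x (eDA (eArr True)) (fst s1) (snd s1) =
      of_bool (defensive_alliance {..<n} E (tog c (width tj * Suc i)))"
    by (rule ev_DA[where S = "eArr True" and r = "fst s1" and A = "tog c (width tj * Suc i)", OF r(1) tog_sub]) (rule ev_arr[OF M])
  have card: "ev x (eCard tj (eArr True)) (fst s1) (snd s1) = of_bool (card_ok tj k (tog c (width tj * Suc i)))"
    by (rule ev_card[where S = "eArr True" and r = "fst s1" and A = "tog c (width tj * Suc i)", OF r tog_sub]) (rule ev_arr[OF M])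
  have "sem x (pStep tj) s = ((fst s1)(vOk := of_bool (\<forall>i'<Suc i. good c i')), snd s1)"
    by (auto simp: pStep_def s1_def[symmetric] DA card ok s(2) good_def less_Suc_eq)
  with s1 show ?thesis by (simp add: tinv_def)
qed

lemma sem_try:
  assumes c: "c < F" and s: "env_ok r" "r vB = b" "repr M False W" "r vC = c"
  shows "env_ok (fst (sem x (pTry tj) (r, M)))" "fst (sem x (pTry tj) (r, M)) vB = b"
    "repr (snd (sem x (pTry tj) (r, M))) False W"
    "fst (sem x (pTry tj) (r, M)) vR = of_bool (r vR \<noteq> 0 \<or> sol c)"
proof -
  define s0 where "s0 = sem x (PSeq (Put vT (Var vC)) (PSeq (Put vOk (Num 1)) (Fill True iv vN (eSrc iv)))) (r, M)"
  define I where "I = (\<lambda>i s'. tinv c (width tj * i) s' \<and> fst s' vOk = of_bool (\<forall>i'<i. good c i') \<and> fst s' vR = r vR)"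
  have n: "r vN = n" using s(1) by (simp add: env_ok_def)
  have "I (fst s0 vM) (sem x (For vI vM (pStep tj)) s0)"
  proof (rule sem_For_invariant)
    show "I 0 s0"
      using s As_sub n by (auto simp: I_def tinv_def s0_def repr_def tog_def ev_src)
    fix i and s' :: "env \<times> arrays"
    assume I: "I i s'"
    have "vR \<notin> wv (pStep tj)"
      by (simp add: pStep_def pToggle_def pDivMod_def eArr_def eNot_def eEq_def eAnd_def eLe_def eLt_def
          eDA_def eCard_def eAdj_def)
    then show "I (Suc i) (sem x (pStep tj) ((fst s')(vI := i), snd s'))"
      using sem_step[OF c, of i "((fst s')(vI := i), snd s')"] I sem_frame[of vR "pStep tj" x]
      by (simp add: I_def tinv_def)
  qed
  moreover have "fst s0 vM = l - 1"
    using s(1) by (simp add: s0_def env_ok_def)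
  ultimately have I: "I (l - 1) (sem x (For vI vM (pStep tj)) s0)" by simp
  define s1 where "s1 = sem x (For vI vM (pStep tj)) s0"
  have s1: "env_ok (fst s1)" "fst s1 vN = n" "fst s1 vB = b" "repr (snd s1) False W"
      "repr (snd s1) True (tog c (width tj * (l - 1)))" "fst s1 vR = r vR"
      "fst s1 vOk = of_bool (\<forall>i'<l - 1. good c i')"
    using I by (simp_all add: I_def tinv_def s1_def env_ok_def)
  have eq: "tog c (width tj * (l - 1)) = At \<longleftrightarrow> (\<forall>v\<in>{..<n}. (v \<in> tog c (width tj * (l - 1))) = (v \<in> At))"
    using tog_sub At_sub by blast
  have "sem x (pTry tj) (r, M) = sem x (Put vR (eOr (Var vR) (eAnd (Var vOk)
         (eNot (Sum iv vN (eNot (eEq (eArr True iv) (eTgt iv)))))))) s1"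
    by (simp only: pTry_def sem.simps s0_def s1_def)
  also have "\<dots> = ((fst s1)(vR := of_bool (r vR \<noteq> 0 \<or> sol c)), snd s1)"
    by (auto simp: s1 ev_arr[OF s1(5)] ev_tgt sol_def eq[unfolded One_nat_def])
  finally show "env_ok (fst (sem x (pTry tj) (r, M)))" "fst (sem x (pTry tj) (r, M)) vB = b"
    "repr (snd (sem x (pTry tj) (r, M))) False W"
    "fst (sem x (pTry tj) (r, M)) vR = of_bool (r vR \<noteq> 0 \<or> sol c)"
    using s1 by simp_all
qed

lemma sol_iff: "(\<exists>c<F. sol c) \<longleftrightarrow> reconfigurable tj {..<n} E As At k l"
  using reconfigurable_search[OF simple DA_As DA_At ok_As ok_At p_eq] l_pos
  by (simp only: sol_def good_def F_def tog_def b_def W_def Z_def simp_thms)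

lemma sem_main:
  assumes "env_ok r"
  shows "fst (sem x (pMain tj) (r, M)) vV \<noteq> 0"
    "fst (sem x (pMain tj) (r, M)) vR = of_bool (reconfigurable tj {..<n} E As At k l)"
proof -
  define s1 where "s1 = sem x (Put vV (eValid tj)) (r, M)"
  have r: "r vP = p" "r vN = n" "r vK = k" "r vL = l"
    using assms by (simp_all add: env_ok_def)
  have "fst s1 vV \<noteq> 0"
    using ev_valid[OF r, of tj M] simple DA_As DA_At ok_As ok_At l_pos by (simp add: s1_def)
  moreover have "fst (sem x (PSeq pSeeds (PSeq pGrow
     (PSeq (Put vB (Add (Sum iv vN (eArr False iv)) (Num 1)))
       (PSeq (Put vR (Num 0)) (For vC vF (pTry tj)))))) s1) vV = fst s1 vV"
    by (rule sem_frame) (simp add: pSeeds_def pGrow_def pTry_def pStep_def pToggle_def pDivMod_def eArr_def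
        eOr_def eNot_def eEq_def eAnd_def eLe_def eLt_def eDA_def eCard_def eAdj_def eSrc_def eTgt_def eLow_def)
  ultimately show "fst (sem x (pMain tj) (r, M)) vV \<noteq> 0"
    by (simp add: pMain_def s1_def)
  have c1: "env_ok (fst s1)" using assms by (simp add: s1_def)
  define s2 where "s2 = sem x pGrow (sem x pSeeds s1)"
  have s2: "env_ok (fst s2)" "repr (snd s2) False W"
    using sem_grow[of "fst (sem x pSeeds s1)" "snd (sem x pSeeds s1)"] sem_seeds[OF c1, of "snd s1"] c1
    by (simp_all add: s2_def)
  define s3 where "s3 = sem x (PSeq (Put vB (Add (Sum iv vN (eArr False iv)) (Num 1))) (Put vR (Num 0))) s2"
  have "fst s2 vN = n" using s2(1) by (simp add: env_ok_def)
  then have s3: "env_ok (fst s3)" "repr (snd s3) False W" "fst s3 vB = b" "fst s3 vR = 0"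
    using s2 card_sum_of_bool[OF W_sub] by (simp_all add: s3_def ev_arr[OF s2(2)] b_def)
  define I where "I = (\<lambda>j s. env_ok (fst s) \<and> repr (snd s) False W \<and> fst s vB = b \<and>
    fst s vR = of_bool (\<exists>c<j. sol c))"
  have "I (fst s3 vF) (sem x (For vC vF (pTry tj)) s3)"
  proof (rule sem_For_invariant)
    show "I 0 s3" using s3 by (simp add: I_def)
    fix c and s' :: "env \<times> arrays"
    assume "c < fst s3 vF" and I: "I c s'"
    then have c: "c < F" using s3(1) by (simp add: env_ok_def)
    show "I (Suc c) (sem x (pTry tj) ((fst s')(vC := c), snd s'))"
      using sem_try[OF c, of "(fst s')(vC := c)" "snd s'"] I by (auto simp: I_def less_Suc_eq)
  qed
  moreover have "sem x (pMain tj) (r, M) = sem x (For vC vF (pTry tj)) s3"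
    by (simp only: pMain_def sem.simps s1_def s2_def s3_def)
  moreover have "fst s3 vF = F" using s3(1) by (simp add: env_ok_def)
  ultimately show "fst (sem x (pMain tj) (r, M)) vR = of_bool (reconfigurable tj {..<n} E As At k l)"
    using sol_iff by (simp add: I_def)
qed

end


section \<open>Running time\<close>

lemma conc_initial: "conc x ((\<lambda>_. 0)(0 := p)) (\<lambda>_ _. 0) (initial x p)"
  by (auto simp: conc_def initial_def)

lemma runs_cprog_Seq:
  assumes "conc x (fst S) (snd S) s" "\<forall>b\<in>bv P. fst S b \<le> B" "bv P \<inter> wv P = {}"
    and "\<And>s'. conc x (fst (sem x P S)) (snd (sem x P S)) s' \<Longrightarrow> runs c s' T Q"
  shows "runs (Seq (cprog P 0) c) s (cst P B + T) Q"
  by (rule runs_Seq[OF cprog_correct[OF assms(1-3)]]) (use assms(4) in \<open>simp add: pspec_def\<close>)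

lemma runs_cprog:
  assumes "conc x (fst S) (snd S) s" "\<forall>b\<in>bv P. fst S b \<le> B" "bv P \<inter> wv P = {}"
  shows "runs (cprog P 0) s (cst P B) (\<lambda>s'. fst s' 0 = fst (sem x P S) 0)"
  by (rule runs_mono[OF cprog_correct[OF assms]])
    (use conc_reg(1)[where i = 0] in \<open>auto simp: pspec_def\<close>)

lemma sem_doubling:
  assumes "i \<noteq> y" "b \<noteq> y" "b \<noteq> i" "fst s y = 1"
  shows "fst (sem x (For i b (Put y (Add (Var y) (Var y)))) s) y = 2 ^ fst s b"
  using sem_For_invariant[of "\<lambda>j s'. fst s' y = 2 ^ j" s b x "Put y (Add (Var y) (Var y))" i] assms
  by simp

text \<open>The constant \<open>a\<close> stays open because this prefix runs for two purposes: with
  5 ahead of the search, and with a larger value to compute the time bound.\<close>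

definition "start x p a = sem x pExp2 (sem x pExp1 (sem x (pInit a) ((\<lambda>_. 0)(0 := p), \<lambda>_ _. 0)))"

lemma start:
  shows "fst (sem x (pInit a) ((\<lambda>_. 0)(0 := p), M)) vX = 4 * p + a"
    "fst (sem x pExp1 (sem x (pInit a) ((\<lambda>_. 0)(0 := p), M))) vY = 2 ^ (4 * p + a)"
    "fst (start x p a) vF = 2 ^ 2 ^ (4 * p + a)"
    "fst (start x p a) vP = p"
    "fst (start x p a) vN = min (ev x (Inp (Num 0)) (fst (start x p a)) (snd (start x p a))) (length x)"
    "fst (start x p a) vK = ev x (Inp (Num 1)) (fst (start x p a)) (snd (start x p a))"
    "fst (start x p a) vL = ev x (Inp (Num 2)) (fst (start x p a)) (snd (start x p a))"
    "fst (start x p a) vM = min (fst (start x p a) vL) p - 1"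
proof -
  let ?s0 = "((\<lambda>_. 0)(0 := p), M)"
  show X: "fst (sem x (pInit a) ((\<lambda>_. 0)(0 := p), M)) vX = 4 * p + a" for M
    by (simp add: pInit_def)
  show Y: "fst (sem x pExp1 (sem x (pInit a) ((\<lambda>_. 0)(0 := p), M))) vY = 2 ^ (4 * p + a)" for M
    unfolding X[of M, symmetric] pExp1_def by (rule sem_doubling) (simp_all add: pInit_def)
  have fr1: "fst (sem x pExp1 s) i = fst s i" if "i \<notin> {iz, vY}" for i s
    by (rule sem_frame) (use that in \<open>simp add: pExp1_def\<close>)
  have fr2: "fst (sem x pExp2 s) i = fst s i" if "i \<notin> {iz, vF}" for i s
    by (rule sem_frame) (use that in \<open>simp add: pExp2_def\<close>)
  show "fst (start x p a) vF = 2 ^ 2 ^ (4 * p + a)"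
    unfolding Y[of "\<lambda>_ _. 0", symmetric] start_def pExp2_def
    by (rule sem_doubling) (simp_all add: fr1, simp add: pInit_def)
  show "fst (start x p a) vP = p"
    "fst (start x p a) vN = min (ev x (Inp (Num 0)) (fst (start x p a)) (snd (start x p a))) (length x)"
    "fst (start x p a) vK = ev x (Inp (Num 1)) (fst (start x p a)) (snd (start x p a))"
    "fst (start x p a) vL = ev x (Inp (Num 2)) (fst (start x p a)) (snd (start x p a))"
    "fst (start x p a) vM = min (fst (start x p a) vL) p - 1"
    by (simp_all add: start_def fr1 fr2 pInit_def) (auto simp: min_def)
qed

text \<open>The two doubling loops are bounded by the lower storeys of the tower, which its top
  dominates since \<open>x < 2 ^ x\<close>.\<close>

lemma runs_start:
  assumes B: "2 ^ 2 ^ (4 * p + a) \<le> B"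
    and "\<And>s'. conc x (fst (start x p a)) (snd (start x p a)) s' \<Longrightarrow> runs c s' T Q"
  shows "runs (Seq (cprog (pInit a) 0) (Seq (cprog pExp1 0) (Seq (cprog pExp2 0) c))) (initial x p)
    (cst (pInit a) B + (cst pExp1 B + (cst pExp2 B + T))) Q"
proof -
  have "4 * p + a \<le> 2 ^ (4 * p + a)" "(2::nat) ^ (4 * p + a) \<le> 2 ^ 2 ^ (4 * p + a)"
    by (rule less_imp_le, rule less_exp)+
  then have le: "4 * p + a \<le> B" "2 ^ (4 * p + a) \<le> B" using B by linarith+
  show ?thesis
  proof (rule runs_cprog_Seq[where S = "((\<lambda>_. 0)(0 := p), \<lambda>_ _. 0)" and x = x])
    fix s1
    assume c1: "conc x (fst (sem x (pInit a) ((\<lambda>_. 0)(0 := p), \<lambda>_ _. 0)))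
      (snd (sem x (pInit a) ((\<lambda>_. 0)(0 := p), \<lambda>_ _. 0))) s1"
    show "runs (Seq (cprog pExp1 0) (Seq (cprog pExp2 0) c)) s1 (cst pExp1 B + (cst pExp2 B + T)) Q"
    proof (rule runs_cprog_Seq[OF c1])
      show "\<forall>b\<in>bv pExp1. fst (sem x (pInit a) ((\<lambda>_. 0)(0 := p), \<lambda>_ _. 0)) b \<le> B"
        using le(1) start(1)[of x a p "\<lambda>_ _. 0"] by (simp add: pExp1_def)
      fix s2
      assume c2: "conc x (fst (sem x pExp1 (sem x (pInit a) ((\<lambda>_. 0)(0 := p), \<lambda>_ _. 0))))
        (snd (sem x pExp1 (sem x (pInit a) ((\<lambda>_. 0)(0 := p), \<lambda>_ _. 0)))) s2"
      show "runs (Seq (cprog pExp2 0) c) s2 (cst pExp2 B + T) Q"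
      proof (rule runs_cprog_Seq[OF c2])
        show "\<forall>b\<in>bv pExp2. fst (sem x pExp1 (sem x (pInit a) ((\<lambda>_. 0)(0 := p), \<lambda>_ _. 0))) b \<le> B"
          using le(2) start(2)[of x a p "\<lambda>_ _. 0"] by (simp add: pExp2_def)
      qed (use assms(2) in \<open>simp_all add: pExp2_def[symmetric] start_def, simp add: pExp2_def\<close>)
    qed (simp add: pExp1_def)
  qed (simp_all add: conc_initial pInit_def)
qed

lemma computable_tower: "computable (\<lambda>p. 2 ^ 2 ^ (4 * p + a))"
  unfolding computable_def
proof (rule exI, rule allI)
  fix p
  let ?P = "Put 0 (Var vF)"
  let ?c = "Seq (cprog (pInit a) 0) (Seq (cprog pExp1 0) (Seq (cprog pExp2 0) (cprog ?P 0)))"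
  let ?B = "2 ^ 2 ^ (4 * p + a)"
  have "runs ?c (initial [] p) (cst (pInit a) ?B + (cst pExp1 ?B + (cst pExp2 ?B + cst ?P ?B)))
      (\<lambda>s'. fst s' 0 = 2 ^ 2 ^ (4 * p + a))"
  proof (rule runs_start[OF order_refl])
    fix s' assume "conc [] (fst (start [] p a)) (snd (start [] p a)) s'"
    from runs_cprog[OF this, of ?P ?B]
    show "runs (cprog ?P 0) s' (cst ?P ?B) (\<lambda>s'. fst s' 0 = 2 ^ 2 ^ (4 * p + a))"
      by (simp add: start(3))
  qed
  then show "\<exists>t s. exec ?c (initial [] p) t s \<and> fst s 0 = 2 ^ 2 ^ (4 * p + a)"
    by (auto simp: runs_def)
qed

text \<open>Taking the power \<open>D\<close> and multiplying by \<open>K\<close> enlarges the lower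
  exponent by at most a factor \<open>2 ^ (1 + K + D)\<close>, which only adds to the upper
  exponent; with the old 5 this gives \<open>6 + K + D\<close>, independent of
  \<open>p\<close>.\<close>

lemma tower_bound: "\<exists>a. \<forall>p. K * (2 * 2 ^ 2 ^ (4 * p + 5)) ^ D \<le> (2 :: nat) ^ 2 ^ (4 * p + a)"
proof (rule exI[of _ "6 + K + D"], rule allI)
  fix p :: nat
  let ?e = "4 * p + 5"
  have K: "K \<le> 2 ^ K" by (rule less_imp_le[OF less_exp])
  have "(2 * 2 ^ 2 ^ ?e) ^ D = (2 :: nat) ^ ((1 + 2 ^ ?e) * D)"
    by (simp only: power_mult power_add power_one_right)
  then have "K * (2 * 2 ^ 2 ^ ?e) ^ D \<le> 2 ^ K * 2 ^ ((1 + 2 ^ ?e) * D)"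
    using K by simp
  also have "\<dots> = 2 ^ (K + (1 + 2 ^ ?e) * D)"
    by (simp only: power_add)
  also have "\<dots> \<le> 2 ^ 2 ^ (4 * p + (6 + K + D))"
  proof (rule power_increasing)
    have "(1 :: nat) \<le> 2 ^ ?e" by (rule one_le_power) simp
    then have "1 + 2 ^ ?e \<le> (2 :: nat) ^ (?e + 1)" by (simp only: power_add power_one_right)
    then have "K + (1 + 2 ^ ?e) * D \<le> K * 2 ^ (?e + 1) + 2 ^ (?e + 1) * D"
      by (intro add_mono mult_right_mono) auto
    also have "\<dots> = 2 ^ (?e + 1) * (K + D)" by (simp add: algebra_simps)
    also have "\<dots> \<le> 2 ^ (?e + 1) * 2 ^ (K + D)"
      by (intro mult_left_mono less_imp_le[OF less_exp]) simp
    also have "\<dots> = 2 ^ (4 * p + (6 + K + D))"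
      by (simp only: power_add[symmetric]) (simp add: algebra_simps)
    finally show "K + (1 + 2 ^ ?e) * D \<le> 2 ^ (4 * p + (6 + K + D))" .
  qed simp
  finally show "K * (2 * 2 ^ 2 ^ ?e) ^ D \<le> 2 ^ 2 ^ (4 * p + (6 + K + D))" .
qed

lemma length_le_input_size: "length x \<le> input_size x"
  unfolding input_size_def by (induction x) auto


section \<open>The reconfiguration problems\<close>

definition DA_Reconf :: "bool \<Rightarrow> parameterized_problem" where
  "DA_Reconf tj = (if tj then DA_Reconf_TJ else DA_Reconf_TAR)"

text \<open>Makes explicit what \<open>eValid\<close> tests. Under token addition and removal the
  size bounds on the endpoints are implicit, because these belong to the sequence;
  \<open>1 \<le> l\<close> holds in both problems because a sequence is nonempty.\<close>

lemma DA_Reconf_iff: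
  "(x, p) \<in> DA_Reconf tj \<longleftrightarrow> (\<exists>n E As At k l. x = encode n E As At k l \<and> yes_shape n E As At k l p tj \<and>
     reconfigurable tj {..<n} E As At k l)" (is "_ \<longleftrightarrow> ?R")
proof
  assume L: "(x, p) \<in> DA_Reconf tj"
  have "\<exists>n E As At k l. x = encode n E As At k l \<and> p = k + l \<and> simple_graph {..<n} E \<and>
    defensive_alliance {..<n} E As \<and> defensive_alliance {..<n} E At \<and> card_ok tj k As \<and> card_ok tj k At \<and>
    1 \<le> l \<and> reconfigurable tj {..<n} E As At k l"
  proof (cases tj)
    case True
    have "1 \<le> l" if "tj_reconfigurable V E As At l" for V :: "nat set" and E As At l
      using that unfolding tj_reconfigurable_def successively_stutter by (rule conjunct1)
    with True L show ?thesis
      unfolding DA_Reconf_def DA_Reconf_TJ_def card_ok_def reconfigurable_def by simp blast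
  next
    case False
    have "1 \<le> l \<and> card As \<le> k \<and> card At \<le> k" if "tar_reconfigurable V E As At k l"
      for V :: "nat set" and E As At k l
      using that unfolding tar_reconfigurable_def successively_stutter by auto
    with False L show ?thesis
      unfolding DA_Reconf_def DA_Reconf_TAR_def card_ok_def reconfigurable_def by simp blast
  qed
  then show ?R
    unfolding yes_shape_def word_def yes_shape_axioms_def
    by (metis defensive_alliance_def simple_graph_def)
next
  assume ?R
  then show "(x, p) \<in> DA_Reconf tj"
    unfolding DA_Reconf_def DA_Reconf_TJ_def DA_Reconf_TAR_def yes_shape_def word_def yes_shape_axioms_def
      card_ok_def reconfigurable_def
    by (cases tj) (simp, blast)+
qed

lemma sem_correct:
  "fst (sem x pOut (sem x (pMain tj) (start x p 5))) 0 = (if (x, p) \<in> DA_Reconf tj then 1 else 0)"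
proof -
  obtain r M where s: "start x p 5 = (r, M)" by fastforce
  have r: "r vF = 2 ^ 2 ^ (4 * p + 5)" "r vP = p" "r vN = min (ev x (Inp (Num 0)) r M) (length x)"
    "r vK = ev x (Inp (Num 1)) r M" "r vL = ev x (Inp (Num 2)) r M" "r vM = min (r vL) p - 1"
    using start(3-8)[of x p 5] unfolding s by simp_all
  let ?s = "sem x (pMain tj) (r, M)"
  have env_ok: "yes_shape.env_ok n k l p r" if Y: "yes_shape n E As At k l p tj"
    and x: "x = encode n E As At k l" for n E As At k l
  proof -
    interpret yes_shape n E As At k l p tj by (rule Y)
    have "encode n E As At k l ! Suc 0 = k" using encode_1 by simp
    then show ?thesis
      unfolding env_ok_def F_def using r p_eq
      by (simp add: x length_encode encode_nonempty encode_0 encode_2 min_def)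
  qed
  \<comment> \<open>The search never writes \<open>vV\<close>, so the verdict on validity survives
    whatever happens on a malformed word.\<close>
  have vV: "fst ?s vV = ev x (eValid tj) r M"
  proof -
    have "fst (sem x (PSeq pSeeds (PSeq pGrow
     (PSeq (Put vB (Add (Sum iv vN (eArr False iv)) (Num 1)))
       (PSeq (Put vR (Num 0)) (For vC vF (pTry tj)))))) (sem x (Put vV (eValid tj)) (r, M))) vV =
       fst (sem x (Put vV (eValid tj)) (r, M)) vV"
      by (rule sem_frame) (simp add: pSeeds_def pGrow_def pTry_def pStep_def pToggle_def pDivMod_def eArr_def
        eOr_def eNot_def eEq_def eAnd_def eLe_def eLt_def eDA_def eCard_def eAdj_def eSrc_def eTgt_def eLow_def)
    then show ?thesis by (simp add: pMain_def)
  qed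
  have main: "fst ?s vV \<noteq> 0 \<and> fst ?s vR = of_bool (reconfigurable tj {..<n} E As At k l)"
    if Y: "yes_shape n E As At k l p tj" and x: "x = encode n E As At k l" for n E As At k l
  proof -
    interpret yes_shape n E As At k l p tj by (rule Y)
    show ?thesis using sem_main[OF env_ok[OF Y x], of M] x by (simp add: x_def)
  qed
  have "fst ?s vV \<noteq> 0 \<and> fst ?s vR \<noteq> 0 \<longleftrightarrow> (x, p) \<in> DA_Reconf tj"
  proof
    assume a: "fst ?s vV \<noteq> 0 \<and> fst ?s vR \<noteq> 0"
    then have valid: "ev x (eValid tj) r M \<noteq> 0" by (simp add: vV)
    then have "ev x eShape r M \<noteq> 0" by (simp add: eValid_def split: if_splits)
    from shape_word[OF r(3-5) this] obtain E As At where
      w: "word (r vN) E As At (r vK) (r vL) p" and x: "x = encode (r vN) E As At (r vK) (r vL)"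
      using r(2) by auto
    interpret word "r vN" E As At "r vK" "r vL" p by (rule w)
    have "yes_shape (r vN) E As At (r vK) (r vL) p tj"
      using ev_valid[OF r(2) refl refl refl, of tj M] valid x w
      by (simp add: yes_shape_def yes_shape_axioms_def x_def)
    with main[OF this x] a x show "(x, p) \<in> DA_Reconf tj"
      unfolding DA_Reconf_iff by (metis of_bool_eq_0_iff)
  next
    assume "(x, p) \<in> DA_Reconf tj"
    then show "fst ?s vV \<noteq> 0 \<and> fst ?s vR \<noteq> 0"
      using main unfolding DA_Reconf_iff by fastforce
  qed
  then show ?thesis by (simp add: pOut_def s)
qed

lemma fpt_DA_Reconf: "fpt (DA_Reconf tj)"
proof -
  let ?all = "PSeq (pInit 5) (PSeq pExp1 (PSeq pExp2 (PSeq (pMain tj) pOut)))"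
  let ?c = "cprog ?all 0"
  obtain K D where KD: "\<And>B. cst ?all B \<le> K * (B + 1) ^ D"
    using poly_bounded_cst[of ?all] unfolding poly_bounded_def by blast
  obtain a where a: "\<And>p. K * (2 * 2 ^ 2 ^ (4 * p + 5)) ^ D \<le> (2 :: nat) ^ 2 ^ (4 * p + a)"
    using tower_bound by blast
  show ?thesis
    unfolding fpt_def
  proof (rule exI[of _ ?c], rule exI[of _ "\<lambda>p. 2 ^ 2 ^ (4 * p + a)"], rule exI[of _ D], intro conjI allI)
    show "computable (\<lambda>p. 2 ^ 2 ^ (4 * p + a))" by (rule computable_tower)
    fix x :: "nat list" and p :: nat
    define F where "F = (2 :: nat) ^ 2 ^ (4 * p + 5)"
    \<comment> \<open>The loop bounds of the search are \<open>F\<close>, \<open>p\<close>,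
      \<open>vN\<close> and \<open>vM\<close>; on every word the last two are at most
      \<open>length x\<close> and \<open>p\<close>.\<close>
    define B where "B = F + length x"
    have F: "p \<le> F" "1 \<le> F"
    proof -
      have "4 * p + 5 < 2 ^ (4 * p + 5)" "(2::nat) ^ (4 * p + 5) < F"
        unfolding F_def by (rule less_exp)+
      then show "p \<le> F" "1 \<le> F" by linarith+
    qed
    have "runs ?c (initial x p) (cst ?all B)
      (\<lambda>s'. fst s' 0 = (if (x, p) \<in> DA_Reconf tj then 1 else 0))"
      unfolding cprog.simps cst.simps
    proof (rule runs_start)
      show "2 ^ 2 ^ (4 * p + 5) \<le> B" by (simp add: B_def F_def)
      fix s1 assume c1: "conc x (fst (start x p 5)) (snd (start x p 5)) s1"
      show "runs (Seq (cprog (pMain tj) 0) (cprog pOut 0)) s1 (cst (pMain tj) B + cst pOut B)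
        (\<lambda>s'. fst s' 0 = (if (x, p) \<in> DA_Reconf tj then 1 else 0))"
      proof (rule runs_cprog_Seq[OF c1])
        have "bv (pMain tj) \<subseteq> {vP, vN, vM, vF}"
          by (simp add: pMain_def pSeeds_def pGrow_def pTry_def pStep_def pToggle_def pDivMod_def eArr_def
            eOr_def eNot_def eEq_def eAnd_def eLe_def eLt_def eDA_def eCard_def eAdj_def eSrc_def eTgt_def
            eLow_def eValid_def eShape_def eGraph_def)
        moreover have "wv (pMain tj) \<inter> {vP, vN, vM, vF} = {}"
          by (simp add: pMain_def pSeeds_def pGrow_def pTry_def pStep_def pToggle_def pDivMod_def eArr_def
            eOr_def eNot_def eEq_def eAnd_def eLe_def eLt_def eDA_def eCard_def eAdj_def eSrc_def eTgt_def
            eLow_def eValid_def eShape_def eGraph_def)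
        moreover have "fst (start x p 5) vN \<le> length x" "fst (start x p 5) vM \<le> p"
          unfolding start(5)[of x p 5] start(8)[of x p 5] by linarith+
        then have "\<forall>b\<in>{vP, vN, vM, vF}. fst (start x p 5) b \<le> B"
          using F start(3,4)[of x p 5] by (simp add: B_def F_def[symmetric])
        ultimately show "\<forall>b\<in>bv (pMain tj). fst (start x p 5) b \<le> B" "bv (pMain tj) \<inter> wv (pMain tj) = {}"
          by blast+
        fix s2
        assume c2: "conc x (fst (sem x (pMain tj) (start x p 5))) (snd (sem x (pMain tj) (start x p 5))) s2"
        show "runs (cprog pOut 0) s2 (cst pOut B) (\<lambda>s'. fst s' 0 = (if (x, p) \<in> DA_Reconf tj then 1 else 0))"
          using runs_cprog[OF c2, of pOut B] sem_correct[where x = x and p = p and tj = tj]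
          by (simp add: pOut_def eAnd_def eNot_def)
      qed
    qed
    then obtain t s where ts: "exec ?c (initial x p) t s" "t \<le> cst ?all B"
      "fst s 0 = (if (x, p) \<in> DA_Reconf tj then 1 else 0)"
      unfolding runs_def by blast
    have "t \<le> 2 ^ 2 ^ (4 * p + a) * (input_size x + 1) ^ D"
    proof -
      \<comment> \<open>Turning the sum into a product separates the parameter from the input size;
        the factor \<open>2 * F\<close> is the base of the power in
        \<open>tower_bound\<close>.\<close>
      have "B + 1 \<le> 2 * F * (input_size x + 1)"
      proof -
        have "input_size x \<le> F * input_size x" using F(2) by simp
        moreover have "2 * F * (input_size x + 1) = 2 * F + 2 * (F * input_size x)"
          by (simp add: algebra_simps)
        ultimately show ?thesis
          using F(2) length_le_input_size[of x] unfolding B_def by linarith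
      qed
      then have "(B + 1) ^ D \<le> (2 * F * (input_size x + 1)) ^ D" by (rule power_mono) simp
      then have "K * (B + 1) ^ D \<le> K * (2 * F) ^ D * (input_size x + 1) ^ D"
        by (simp only: power_mult_distrib mult.assoc mult_le_mono2)
      also have "\<dots> \<le> 2 ^ 2 ^ (4 * p + a) * (input_size x + 1) ^ D"
        using a[of p] by (intro mult_right_mono) (simp_all add: F_def)
      finally show ?thesis using ts(2) KD[of B] by linarith
    qed
    with ts(1,3) show "\<exists>t s. exec ?c (initial x p) t s \<and>
       t \<le> 2 ^ 2 ^ (4 * p + a) * (input_size x + 1) ^ D \<and>
       fst s 0 = (if (x, p) \<in> DA_Reconf tj then 1 else 0)"
      by blast
  qed
qed

theorem theorem6:
  shows "fpt DA_Reconf_TAR \<and> fpt DA_Reconf_TJ"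
  using fpt_DA_Reconf[of False] fpt_DA_Reconf[of True] by (simp add: DA_Reconf_def)

end
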